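(* Let $\{X_t\}_{t\in\mathbb{Z}}$ be the stationary (squared) ARCH$(\infty)$ process satisfying $$X_t=Z_t\Bigl(a_0+\sum_{j=1}^\infty a_jX_{t-j}\Bigr),\qquad t\in\mathbb{Z},$$ where $\{Z_t\}$ are i.i.d. positive random variables with $\mathbb{E}(Z_t)=1$ and density $f_Z$, and $a_j$ are positive parameters. Suppose that $a_0>0$, that $\sum_{j=1}^\infty a_j<1-\delta_0$ for some $\delta_0>0$, that $\mathbb{E}|X_t|^\nu<\infty$ for some $\nu>1$, and that for all $a>0$, $\int|f_Z(u)-f_Z(u[1+a])|\,du\le K_0a$ for some finite $K_0$ independent of $a$. Let $\{\psi_j\}_{j\ge0}$ be defined by $(1-\sum_{j=1}^\infty a_jz^j)^{-1}=\sum_{j=0}^\infty\psi_jz^j$ for $|z|\le1$. Then for $k\ge1$ $$\sup_{G\in\sigma(X_k),\,H\in\mathcal{F}_0^{-\infty}}|P(G\cap H)-P(G)P(H)|\le K(\nu)\sum_{i=0}^\infty\Biggl[\frac1{a_0}\sum_{j=0}^{k-1}|\psi_j|\,a_{k-j+i}\Biggr]^{\nu/(\nu+1)}\bigl[\mathbb{E}|X_0|^\nu\bigr]^{1/(\nu+1)},$$ where $K(\nu)=3\bigl(\nu^{1/(1+\nu)}+\nu^{-\nu/(\nu+1)}\bigr)$. If, in addition, $a_j\sim j^{-\delta}$ and $|\psi_j|\sim j^{-\delta}$, then $$\sup_{G\in\sigma(X_k),\,H\in\mathcal{F}_0^{-\infty}}|P(G\cap H)-P(G)P(H)|\le K\cdot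 k(k+1)^{-\tilde\delta+1},$$ where $\tilde\delta=\delta\times\frac{\nu}{\nu+1}$ and $K$ is a finite constant (not depending on $k$).
   Context: $\mathcal{F}_0^{-\infty}=\sigma(X_0,X_{-1},\ldots)$. The process is the causal stationary solution of the recursion (which exists, with finite mean, under the stated assumptions on $\{a_j\}$), so that $Z_\tau$ is independent of $(X_t,X_{t-1},\ldots)$ for $\tau>t$. The relation $u_j\sim v_j$ means that $u_j$ is of the order of $v_j$ as $j\to\infty$.
   Formalization: The first bound is proved with the extra factor K_0^{ν/(ν+1)} on the right-hand side; without it the inequality fails, e.g. for innovations concentrated near two points with small a_1. The factor is 1 when K_0=1. *)

theory Defs
  imports "HOL-Probability.Probability" "HOL-Library.Landau_Symbols"
begin

text \<open>The sigma-algebra on \<open>space M\<close> generated by the variables \<open>X t\<close>, \<open>t \<in> T\<close>.\<close>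

definition generated_by :: "'a measure \<Rightarrow> (int \<Rightarrow> 'a \<Rightarrow> real) \<Rightarrow> int set \<Rightarrow> 'a set set" where
  "generated_by M X T =
     sigma_sets (space M) (\<Union>t\<in>T. {X t -` B \<inter> space M | B. B \<in> sets borel})"

definition mixing_coeff :: "'a measure \<Rightarrow> 'a set set \<Rightarrow> 'a set set \<Rightarrow> real" where
  "mixing_coeff M \<A> \<B> =
     (SUP (G, H)\<in>\<A> \<times> \<B>. \<bar>measure M (G \<inter> H) - measure M G * measure M H\<bar>)"

definition strictly_stationary :: "'a measure \<Rightarrow> (int \<Rightarrow> 'a \<Rightarrow> real) \<Rightarrow> bool" where
  "strictly_stationary M X \<longleftrightarrow>
     (\<forall>t. X t \<in> borel_measurable M) \<and>
     (\<forall>h. distr M (\<Pi>\<^sub>M t\<in>UNIV. borel) (\<lambda>\<omega> t. X (t + h) \<omega>) =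
          distr M (\<Pi>\<^sub>M t\<in>UNIV. borel) (\<lambda>\<omega> t. X t \<omega>))"

definition causal_in :: "'a measure \<Rightarrow> (int \<Rightarrow> 'a \<Rightarrow> real) \<Rightarrow> (int \<Rightarrow> 'a \<Rightarrow> real) \<Rightarrow> bool" where
  "causal_in M Z X \<longleftrightarrow>
     (\<forall>t. \<exists>g \<in> borel_measurable (\<Pi>\<^sub>M n\<in>(UNIV :: nat set). (borel :: real measure)).
        AE \<omega> in M. X t \<omega> = g (\<lambda>n. Z (t - int n) \<omega>))"

text \<open>\<open>a 0\<close> is the constant term of the recursion, and \<open>a (Suc j)\<close> is the coefficient of
  lag \<open>Suc j\<close>.\<close>

definition arch_infinity :: "'a measure \<Rightarrow> (nat \<Rightarrow> real) \<Rightarrow> (int \<Rightarrow> 'a \<Rightarrow> real) \<Rightarrow>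
    (int \<Rightarrow> 'a \<Rightarrow> real) \<Rightarrow> bool" where
  "arch_infinity M a Z X \<longleftrightarrow>
     strictly_stationary M X \<and> causal_in M Z X \<and>
     (\<forall>t. AE \<omega> in M.
        summable (\<lambda>j. a (Suc j) * X (t - int (Suc j)) \<omega>) \<and>
        X t \<omega> = Z t \<omega> * (a 0 + (\<Sum>j. a (Suc j) * X (t - int (Suc j)) \<omega>)))"

text \<open>This constant alone cannot serve in the mixing bound: the bound must also grow with the
  constant \<open>K0\<close> of the scaling condition \<open>\<integral> \<bar>f u - f (u (1 + b))\<bar> du \<le> K0 b\<close> on the innovation
  density, since nearly discrete innovations give a mixing coefficient close to \<open>1/4\<close> for
  arbitrarily small lag coefficients. It is therefore used with the extra factor
  \<open>K0 powr (\<nu> / (\<nu> + 1))\<close>. The scaling condition forces \<open>K0 \<ge> 1\<close>, and the factor is 1 for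
  \<open>K0 = 1\<close>, which every nonincreasing density on the positive half-line admits.\<close>

definition K_nu :: "real \<Rightarrow> real" where
  "K_nu \<nu> = 3 * (\<nu> powr (1 / (1 + \<nu>)) + \<nu> powr (- \<nu> / (\<nu> + 1)))"

end

theory Submission
  imports Defs "HOL-Real_Asymp.Real_Asymp"
begin

text \<open>Write \<open>X t = Z t * vol t\<close>. For \<open>k \<ge> 1\<close>, \<open>vol k\<close> is an affine function of the past values
  \<open>X 0, X (- 1), \<dots>\<close> whose coefficients depend only on the innovations \<open>Z 1, \<dots>, Z (k - 1)\<close>;
  let \<open>vol0 k\<close> be its value for a vanishing past, which is independent of the past. Given the
  innovations before time \<open>k\<close>, the variable \<open>X k\<close> is distributed as \<open>Z k\<close> scaled by \<open>vol k\<close>. Rescaling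
  to \<open>vol0 k\<close> changes this law by at most \<open>2 K0 (vol k - vol0 k) / a 0\<close> in total variation,
  and of course by at most 1. Hence the mixing coefficient is at most
  \<open>E min(1, 2 K0 (vol k - vol0 k) / a 0)\<close>. By \<open>min(1, \<Sum> y i) \<le> \<Sum> (y i)^p\<close>
  with \<open>p = \<nu> / (\<nu> + 1)\<close>, independence and Jensen's inequality, this is bounded by a sum
  over \<open>i\<close> in which the mean of the coefficient of \<open>X (- i)\<close> appears. These means solve the renewal
  equation, so they are \<open>\<Sum>j<k. \<psi> j * a (k - j + i)\<close>.\<close>

section \<open>Linear Volterra recursions\<close>

text \<open>Only positive times matter: \<open>z\<close> and \<open>b\<close> are never used at \<open>0\<close> in the values at \<open>t \<ge> 1\<close>.\<close>

fun volterra :: "(nat \<Rightarrow> real) \<Rightarrow> (nat \<Rightarrow> real) \<Rightarrow> (nat \<Rightarrow> real) \<Rightarrow> nat \<Rightarrow> real" where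
  "volterra a z b t = b t + (\<Sum>s\<in>{1..<t}. a (t - s) * z s * volterra a z b s)"

declare volterra.simps [simp del]

lemma volterra_nonneg:
  assumes "\<And>j. 0 \<le> a j" "\<And>s. 1 \<le> s \<Longrightarrow> 0 \<le> z s" "\<And>s. 1 \<le> s \<Longrightarrow> 0 \<le> b s" "1 \<le> t"
  shows "0 \<le> volterra a z b t"
  using assms(4)
proof (induction t rule: less_induct)
  case (less t)
  show ?case
    by (subst volterra.simps) (use less assms in \<open>auto intro!: add_nonneg_nonneg sum_nonneg mult_nonneg_nonneg\<close>)
qed

text \<open>The value at \<open>t\<close> is determined by the values at earlier times, so strong
  induction applies. This identifies the volatility along a sample path with a Volterra
  solution.\<close>

lemma volterra_unique:
  assumes "\<And>t. 1 \<le> t \<Longrightarrow> y t = b t + (\<Sum>s\<in>{1..<t}. a (t - s) * z s * y s)" "1 \<le> t"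
  shows "y t = volterra a z b t"
  using assms(2)
proof (induction t rule: less_induct)
  case (less t)
  have "(\<Sum>s\<in>{1..<t}. a (t - s) * z s * y s) = (\<Sum>s\<in>{1..<t}. a (t - s) * z s * volterra a z b s)"
    by (rule sum.cong) (use less in auto)
  then show ?case
    using assms(1)[OF less.prems] by (subst volterra.simps) simp
qed

text \<open>Linearity in the forcing term \<open>b\<close> is what separates the constant
  \<open>a 0\<close> from the contribution of the past.\<close>

lemma volterra_add:
  "volterra a z (\<lambda>s. b s + c s) t = volterra a z b t + volterra a z c t"
proof (induction t rule: less_induct)
  case (less t)
  have "(\<Sum>s\<in>{1..<t}. a (t - s) * z s * volterra a z (\<lambda>s. b s + c s) s)
      = (\<Sum>s\<in>{1..<t}. a (t - s) * z s * volterra a z b s)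
        + (\<Sum>s\<in>{1..<t}. a (t - s) * z s * volterra a z c s)"
    unfolding sum.distrib[symmetric] by (rule sum.cong) (use less in \<open>auto simp: algebra_simps\<close>)
  then show ?case
    by (subst (1 2 3) volterra.simps) simp
qed

text \<open>Here \<open>c\<close> will be a past value \<open>X (- i)\<close>, constant in the time
  variable of the recursion, so it can be pulled out.\<close>

lemma volterra_cmult:
  "volterra a z (\<lambda>s. b s * c) t = volterra a z b t * c"
proof (induction t rule: less_induct)
  case (less t)
  have "(\<Sum>s\<in>{1..<t}. a (t - s) * z s * volterra a z (\<lambda>s. b s * c) s)
      = (\<Sum>s\<in>{1..<t}. a (t - s) * z s * volterra a z b s) * c"
    unfolding sum_distrib_right by (rule sum.cong) (use less in \<open>auto simp: algebra_simps\<close>)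
  then show ?case
    by (subst (1 2) volterra.simps) (simp add: algebra_simps)
qed

text \<open>The past enters the forcing term as an infinite series. Each recursion step is a finite
  linear combination, so convergence passes through it termwise.\<close>

lemma volterra_sums:
  assumes "\<And>s. 1 \<le> s \<Longrightarrow> (\<lambda>i. c i s) sums b s" "1 \<le> t"
  shows "(\<lambda>i. volterra a z (c i) t) sums volterra a z b t"
  using assms(2)
proof (induction t rule: less_induct)
  case (less t)
  show ?case
    by (subst (1 2) volterra.simps, intro sums_add sums_sum sums_mult) (use less assms in auto)
qed

text \<open>For unit innovations the recursion is a convolution. In generating functions it reads
  \<open>D = B + D * A\<close>, so \<open>D\<close> is \<open>B\<close> divided by
  \<open>1 - A\<close>, and \<open>\<psi>\<close> holds the coefficients of that reciprocal.\<close>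

lemma volterra_renewal:
  assumes \<psi>: "Abs_fps \<psi> * (1 - Abs_fps (\<lambda>n. if n = 0 then 0 else a n)) = 1" and t: "1 \<le> t"
  shows "volterra a (\<lambda>_. 1) b t = (\<Sum>j<t. \<psi> j * b (t - j))"
proof -
  define A where "A = Abs_fps (\<lambda>n. if n = 0 then 0 else a n)"
  define B where "B = Abs_fps (\<lambda>n. if n = 0 then 0 else b n)"
  define D where "D = Abs_fps (\<lambda>n. if n = 0 then 0 else volterra a (\<lambda>_. 1) b n)"
  have "D = B + D * A"
  proof (rule fps_ext)
    fix n
    show "fps_nth D n = fps_nth (B + D * A) n"
    proof (cases "n = 0")
      case False
      have "(\<Sum>i=0..n. fps_nth D i * fps_nth A (n - i))
          = (\<Sum>i\<in>{1..<n}. a (n - i) * 1 * volterra a (\<lambda>_. 1) b i)"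
        by (rule sum.mono_neutral_cong_right) (auto simp: A_def D_def)
      then show ?thesis
        using False by (simp add: fps_mult_nth B_def) (simp add: D_def volterra.simps[of a _ b n])
    qed (simp add: A_def B_def D_def fps_mult_nth)
  qed
  then have "D * (1 - A) = B" by (simp add: algebra_simps)
  then have "D = Abs_fps \<psi> * B"
    using \<psi> unfolding A_def[symmetric] by (metis mult.assoc mult.commute mult_1)
  then have "fps_nth D t = (\<Sum>j=0..t. \<psi> j * fps_nth B (t - j))"
    by (simp add: fps_mult_nth)
  also have "\<dots> = (\<Sum>j<t. \<psi> j * b (t - j))"
    by (rule sum.mono_neutral_cong_right) (auto simp: B_def)
  finally show ?thesis using t by (simp add: D_def)
qed

text \<open>The analytic hypothesis becomes a formal identity: both series converge on the unit
  disc, their values multiply to 1 there, and a power series is determined by its values near 0. The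
  sum of the \<open>a j\<close> lies below 1, which keeps the denominator away from 0.\<close>

lemma renewal_fps:
  fixes a \<psi> :: "nat \<Rightarrow> real"
  assumes a: "\<And>j. 0 < a j" "summable (\<lambda>j. a (Suc j))" "(\<Sum>j. a (Suc j)) < 1"
    and \<psi>: "\<And>z :: complex. norm z \<le> 1 \<Longrightarrow>
        (\<lambda>j. of_real (\<psi> j) * z ^ j) sums
          inverse (1 - (\<Sum>j. of_real (a (Suc j)) * z ^ Suc j))"
  shows "Abs_fps \<psi> * (1 - Abs_fps (\<lambda>n. if n = 0 then 0 else a n)) = 1"
proof -
  define P where "P = Abs_fps (\<lambda>n. complex_of_real (\<psi> n))"
  define A where "A = Abs_fps (\<lambda>n. complex_of_real (if n = 0 then 0 else a n))"
  have sA: "summable (\<lambda>j. complex_of_real (a (Suc j)) * z ^ Suc j)"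
    and nA: "norm (\<Sum>j. complex_of_real (a (Suc j)) * z ^ Suc j) < 1" if z: "norm z \<le> 1" for z
  proof -
    have le: "norm (complex_of_real (a (Suc j)) * z ^ Suc j) \<le> a (Suc j)" for j
      using z a(1)[of "Suc j"] power_le_one[of "norm z" "Suc j"]
      by (simp add: norm_mult norm_power mult_left_le del: power_Suc)
    show s: "summable (\<lambda>j. complex_of_real (a (Suc j)) * z ^ Suc j)"
      by (rule summable_comparison_test'[OF a(2), of 0]) (use le in auto)
    have "norm (\<Sum>j. complex_of_real (a (Suc j)) * z ^ Suc j) \<le> (\<Sum>j. a (Suc j))"
      by (rule norm_suminf_le[OF le a(2)])
    then show "norm (\<Sum>j. complex_of_real (a (Suc j)) * z ^ Suc j) < 1"
      using a(3) by simp
  qed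
  have eA: "(\<lambda>n. fps_nth A n * z ^ n) sums (\<Sum>j. complex_of_real (a (Suc j)) * z ^ Suc j)"
    if "norm z \<le> 1" for z
  proof -
    have "(\<lambda>n. fps_nth A (Suc n) * z ^ Suc n) sums (\<Sum>j. complex_of_real (a (Suc j)) * z ^ Suc j)"
      using summable_sums[OF sA[OF that]] by (simp add: A_def)
    from sums_Suc[OF this] show ?thesis by (simp add: A_def)
  qed
  \<comment> \<open>Convergence at the single point 1 already forces a radius of convergence of at
    least 1.\<close>
  have rP: "fps_conv_radius P \<ge> 1"
    unfolding fps_conv_radius_def
    using conv_radius_geI[of "fps_nth P" 1] sums_summable[OF \<psi>[of 1]]
    by (simp add: P_def one_ereal_def)
  have rA: "fps_conv_radius A \<ge> 1"
    unfolding fps_conv_radius_def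
    using conv_radius_geI[of "fps_nth A" 1] sums_summable[OF eA[of 1]]
    by (simp add: one_ereal_def)
  have r1A: "fps_conv_radius (1 - A) \<ge> 1"
    using fps_conv_radius_diff[of 1 A] rA by (simp add: min_def split: if_splits)
  have "P * (1 - A) = 1"
  proof (rule eval_fps_eqD)
    show "fps_conv_radius (P * (1 - A)) > 0"
      by (rule less_le_trans[OF _ order_trans[OF min.boundedI[OF rP r1A] fps_conv_radius_mult]]) simp
    show "eventually (\<lambda>z. eval_fps (P * (1 - A)) z = eval_fps 1 z) (nhds 0)"
      unfolding eventually_nhds_metric
    proof (intro exI[of _ 1] conjI allI impI)
      fix z :: complex assume "dist z 0 < 1"
      then have z: "norm z < 1" by simp
      then have z': "ereal (norm z) < 1" by (simp add: one_ereal_def)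
      have "eval_fps P z = inverse (1 - (\<Sum>j. of_real (a (Suc j)) * z ^ Suc j))"
        unfolding eval_fps_def using sums_unique[OF \<psi>[of z]] z by (simp add: P_def)
      moreover have "eval_fps A z = (\<Sum>j. of_real (a (Suc j)) * z ^ Suc j)"
        unfolding eval_fps_def using sums_unique[OF eA[of z]] z by simp
      moreover have "1 - (\<Sum>j. of_real (a (Suc j)) * z ^ Suc j) \<noteq> 0"
        using nA[of z] z by (auto simp del: power_Suc)
      moreover have "eval_fps (P * (1 - A)) z = eval_fps P z * (1 - eval_fps A z)"
        using eval_fps_mult[OF less_le_trans[OF z' rP] less_le_trans[OF z' r1A]]
          eval_fps_diff[of z 1, OF _ less_le_trans[OF z' rA]] by simp
      ultimately show "eval_fps (P * (1 - A)) z = eval_fps 1 z" by simp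
    qed simp
  qed simp
  then have *: "fps_nth (P * (1 - A)) n = fps_nth 1 n" for n by simp
  show ?thesis
  proof (rule fps_ext)
    fix n
    have "complex_of_real (fps_nth (Abs_fps \<psi> * (1 - Abs_fps (\<lambda>n. if n = 0 then 0 else a n))) n)
        = fps_nth (P * (1 - A)) n"
      by (auto simp: fps_mult_nth P_def A_def intro!: sum.cong)
    then show "fps_nth (Abs_fps \<psi> * (1 - Abs_fps (\<lambda>n. if n = 0 then 0 else a n))) n = fps_nth 1 n"
      unfolding * by (cases "n = 0") auto
  qed
qed

section \<open>Polynomially decaying lag coefficients\<close>

text \<open>Comparison with a telescoping series: by the mean value theorem the decrement of
  \<open>m powr (1 - q)\<close> from \<open>m\<close> to \<open>m + 1\<close> is
  \<open>(q - 1) * z powr (- q)\<close> with \<open>z\<close> in between. The factor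
  \<open>2 powr q\<close> comes from \<open>z < m + 1 \<le> 2 * m\<close>.\<close>

lemma powr_sum_tail_le:
  fixes q :: real
  assumes q: "1 < q"
  shows "(\<lambda>i. real (Suc k + i) powr (- q)) sums (\<Sum>i. real (Suc k + i) powr (- q))"
    and "(\<Sum>i. real (Suc k + i) powr (- q)) \<le> 2 powr q / (q - 1) * (real k + 1) powr (1 - q)"
proof -
  define u where "u i = real (Suc k + i) powr (1 - q)" for i
  define C where "C = 2 powr q / (q - 1)"
  have C: "0 < C" using q by (simp add: C_def)
  have step: "real (Suc k + i) powr (- q) \<le> C * (u i - u (Suc i))" for i
  proof -
    define m where "m = real (Suc k + i)"
    have m: "1 \<le> m" by (simp add: m_def)
    have "\<exists>z>m. z < m + 1 \<and> (m + 1) powr (1 - q) - m powr (1 - q) = (m + 1 - m) * ((1 - q) * z powr (1 - q - 1))"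
      using has_real_derivative_powr[of _ "1 - q"] m by (intro MVT2) auto
    then obtain z where z: "m < z" "z < m + 1"
      and "(m + 1) powr (1 - q) - m powr (1 - q) = (m + 1 - m) * ((1 - q) * z powr (1 - q - 1))" by blast
    then have eq: "(m + 1) powr (1 - q) - m powr (1 - q) = (1 - q) * z powr (- q)" by simp
    have "(2 * m) powr (- q) \<le> z powr (- q)"
      using m z q by (intro powr_mono2') auto
    then have "m powr (- q) \<le> 2 powr q * z powr (- q)"
      using m by (simp add: powr_mult powr_minus field_simps)
    also have "\<dots> = C * ((q - 1) * z powr (- q))" using q by (simp add: C_def)
    also have "(q - 1) * z powr (- q) = u i - u (Suc i)"
      using eq by (simp add: u_def m_def algebra_simps)
    finally show ?thesis by (simp add: m_def)
  qed
  have "u \<longlonglongrightarrow> 0" unfolding u_def using q by real_asymp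
  then have "(\<lambda>i. u i - u (Suc i)) sums (u 0 - 0)" by (rule telescope_sums')
  then have tel: "(\<lambda>i. C * (u i - u (Suc i))) sums (C * u 0)"
    using sums_mult by fastforce
  have sm: "summable (\<lambda>i. real (Suc k + i) powr (- q))"
    by (rule summable_comparison_test'[OF sums_summable[OF tel], of 0]) (use step in auto)
  then show "(\<lambda>i. real (Suc k + i) powr (- q)) sums (\<Sum>i. real (Suc k + i) powr (- q))"
    by (rule summable_sums)
  have "(\<Sum>i. real (Suc k + i) powr (- q)) \<le> C * u 0"
    using suminf_le[OF step sm sums_summable[OF tel]] sums_unique[OF tel] by simp
  then show "(\<Sum>i. real (Suc k + i) powr (- q)) \<le> 2 powr q / (q - 1) * (real k + 1) powr (1 - q)"
    by (simp add: u_def C_def add.commute)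
qed

text \<open>The eventual bound is made valid at every index. The shift to \<open>j + 1\<close>
  matters at 0, because \<open>0 powr x = 0\<close> and the unshifted bound would force
  \<open>g 0 = 0\<close>.\<close>

lemma bigo_powr_bound:
  fixes g :: "nat \<Rightarrow> real"
  assumes "g \<in> O(\<lambda>j. real j powr (- \<delta>))"
  obtains C where "0 < C" "\<And>j. \<bar>g j\<bar> \<le> C * (real j + 1) powr (- \<delta>)"
proof -
  have "(\<lambda>j. real j powr (- \<delta>)) \<in> O(\<lambda>j. (real j + 1) powr (- \<delta>))" by real_asymp
  with assms have "g \<in> O(\<lambda>j. (real j + 1) powr (- \<delta>))" by (rule landau_o.big_trans)
  then obtain c where c: "0 < c" "eventually (\<lambda>j. norm (g j) \<le> c * norm ((real j + 1) powr (- \<delta>))) sequentially"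
    by (elim landau_o.bigE)
  then obtain N where N: "\<And>j. N \<le> j \<Longrightarrow> \<bar>g j\<bar> \<le> c * (real j + 1) powr (- \<delta>)"
    by (auto simp: eventually_sequentially)
  \<comment> \<open>Each of the finitely many exceptional indices contributes its own ratio to the
    constant.\<close>
  define C where "C = c + (\<Sum>j<N. \<bar>g j\<bar> / (real j + 1) powr (- \<delta>))"
  show thesis
  proof
    show "0 < C" using c(1) by (auto simp: C_def intro!: add_pos_nonneg sum_nonneg)
    show "\<bar>g j\<bar> \<le> C * (real j + 1) powr (- \<delta>)" for j
    proof (cases "N \<le> j")
      case True
      have "c \<le> C" by (auto simp: C_def intro!: sum_nonneg)
      with N[OF True] show ?thesis
        by (meson mult_right_mono order_trans powr_ge_zero)
    next
      case False
      then have "\<bar>g j\<bar> / (real j + 1) powr (- \<delta>) \<le> (\<Sum>j<N. \<bar>g j\<bar> / (real j + 1) powr (- \<delta>))"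
        by (intro member_le_sum) auto
      then have "\<bar>g j\<bar> / (real j + 1) powr (- \<delta>) \<le> C" using c(1) by (simp add: C_def)
      then show ?thesis by (simp add: divide_le_eq)
    qed
  qed
qed

text \<open>Each of the \<open>k\<close> summands obeys the same bound, since
  \<open>(j + 1) * (k - j + i + 1) \<ge> k + i + 1\<close> for \<open>j < k\<close>. This is the
  origin of the factor \<open>k\<close> in the rate.\<close>

lemma convolution_powr_bound:
  fixes a \<psi> :: "nat \<Rightarrow> real"
  assumes "0 \<le> \<delta>" "0 \<le> C" "\<And>j. 0 \<le> a j"
    and a: "\<And>j. \<bar>a j\<bar> \<le> C * (real j + 1) powr (- \<delta>)"
    and \<psi>: "\<And>j. \<bar>\<psi> j\<bar> \<le> D * (real j + 1) powr (- \<delta>)"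
  shows "(\<Sum>j<k. \<bar>\<psi> j\<bar> * a (k - j + i)) \<le> real k * (D * C * real (Suc k + i) powr (- \<delta>))"
proof -
  have D: "0 \<le> D" using \<psi>[of 0] by simp
  have "\<bar>\<psi> j\<bar> * a (k - j + i) \<le> D * C * real (Suc k + i) powr (- \<delta>)" if "j < k" for j
  proof -
    have r: "real (k - j + i) = real k - real j + real i" using that by simp
    have "0 \<le> real j * (real (k - j + i))" by simp
    then have le: "real (Suc k + i) \<le> (real j + 1) * (real (k - j + i) + 1)"
      unfolding r by (simp add: algebra_simps)
    have "\<bar>\<psi> j\<bar> * a (k - j + i)
        \<le> (D * (real j + 1) powr (- \<delta>)) * (C * (real (k - j + i) + 1) powr (- \<delta>))"
      using assms(2,3) \<psi>[of j] a[of "k - j + i"] D by (intro mult_mono) auto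
    also have "\<dots> = D * C * ((real j + 1) * (real (k - j + i) + 1)) powr (- \<delta>)"
      by (simp add: powr_mult)
    also have "\<dots> \<le> D * C * real (Suc k + i) powr (- \<delta>)"
      using le assms D by (intro mult_left_mono powr_mono2') auto
    finally show ?thesis .
  qed
  then show ?thesis
    using sum_bounded_above[of "{..<k}" "\<lambda>j. \<bar>\<psi> j\<bar> * a (k - j + i)"] by simp
qed

text \<open>For \<open>\<delta> * p \<le> 1\<close> the bound is trivial, since its right-hand side is at least one.\<close>

lemma mixing_rate_powr:
  fixes \<alpha> :: "nat \<Rightarrow> real"
  assumes p: "0 < p" "p \<le> 1" and a: "\<And>j. 0 \<le> a j" and c: "0 \<le> c" "0 \<le> m" "0 \<le> L"
    and \<alpha>1: "\<And>k. \<alpha> k \<le> 1"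
    and bound: "\<And>k. 1 \<le> k \<Longrightarrow> ennreal (\<alpha> k) \<le> ennreal L *
        (\<Sum>i. ennreal ((c * (\<Sum>j<k. \<bar>\<psi> j\<bar> * a (k - j + i))) powr p * m))"
    and \<delta>: "a \<in> O(\<lambda>j. real j powr (- \<delta>))" "(\<lambda>j. \<bar>\<psi> j\<bar>) \<in> O(\<lambda>j. real j powr (- \<delta>))"
  shows "\<exists>K. \<forall>k\<ge>1. \<alpha> k \<le> K * (real k * (real k + 1) powr (- (\<delta> * p) + 1))"
proof (cases "1 < \<delta> * p")
  case False
  have "\<alpha> k \<le> 1 * (real k * (real k + 1) powr (- (\<delta> * p) + 1))" if "1 \<le> k" for k
  proof -
    have "1 \<le> (real k + 1) powr (- (\<delta> * p) + 1)" using False by (intro ge_one_powr_ge_zero) auto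
    then have "1 * 1 \<le> real k * (real k + 1) powr (- (\<delta> * p) + 1)" using that by (intro mult_mono) auto
    with \<alpha>1[of k] show ?thesis by simp
  qed
  then show ?thesis by blast
next
  case True
  define q where "q = \<delta> * p"
  have q: "1 < q" using True by (simp add: q_def)
  have \<delta>0: "0 \<le> \<delta>" using True p by (metis less_eq_real_def mult_nonpos_nonneg not_less order.trans zero_le_one)
  obtain C where C: "0 < C" "\<And>j. \<bar>a j\<bar> \<le> C * (real j + 1) powr (- \<delta>)"
    using bigo_powr_bound[OF \<delta>(1)] by blast
  obtain D where D: "0 < D" "\<And>j. \<bar>\<psi> j\<bar> \<le> D * (real j + 1) powr (- \<delta>)"
    using bigo_powr_bound[OF \<delta>(2)] by auto
  define E where "E = L * ((c * D * C) powr p * m) * (2 powr q / (q - 1))"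
  have "\<alpha> k \<le> E * (real k * (real k + 1) powr (- q + 1))" if k: "1 \<le> k" for k
  proof -
    define G where "G = real k * (c * D * C) powr p * m"
    have G: "0 \<le> G" using c by (simp add: G_def)
    have summand: "(c * (\<Sum>j<k. \<bar>\<psi> j\<bar> * a (k - j + i))) powr p * m \<le> G * real (Suc k + i) powr (- q)" for i
    proof -
      have "(c * (\<Sum>j<k. \<bar>\<psi> j\<bar> * a (k - j + i))) powr p
          \<le> (c * (real k * (D * C * real (Suc k + i) powr (- \<delta>)))) powr p"
        using c a p C D \<delta>0
        by (intro powr_mono2 mult_left_mono convolution_powr_bound mult_nonneg_nonneg sum_nonneg) auto
      also have "\<dots> = real k powr p * ((c * D * C) powr p * real (Suc k + i) powr (- q))"
        using c C D by (simp add: powr_mult powr_powr q_def mult_ac)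
      \<comment> \<open>The power \<open>k^p\<close> is relaxed to \<open>k\<close>, which gives the
        linear factor of the stated rate.\<close>
      also have "\<dots> \<le> real k * ((c * D * C) powr p * real (Suc k + i) powr (- q))"
      proof -
        have "real k powr p \<le> real k powr 1" using k p by (intro powr_mono) auto
        then show ?thesis by (intro mult_right_mono) auto
      qed
      finally show ?thesis
        using c mult_right_mono[of _ _ m] by (fastforce simp: G_def mult_ac)
    qed
    have "ennreal (\<alpha> k) \<le> ennreal L * (\<Sum>i. ennreal (G * real (Suc k + i) powr (- q)))"
      using bound[OF k] summand
      by (elim order_trans) (intro mult_left_mono suminf_le ennreal_leI, auto)
    also have "(\<Sum>i. ennreal (G * real (Suc k + i) powr (- q)))
        = ennreal (G * (\<Sum>i. real (Suc k + i) powr (- q)))"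
      using sums_mult[OF powr_sum_tail_le(1)[OF q, of k], of G] G
      by (subst suminf_ennreal2) (auto simp: sums_iff)
    also have "ennreal L * \<dots> \<le> ennreal L * ennreal (G * (2 powr q / (q - 1) * (real k + 1) powr (1 - q)))"
      using powr_sum_tail_le(2)[OF q, of k] G by (intro mult_left_mono ennreal_leI) auto
    also have "\<dots> = ennreal (E * (real k * (real k + 1) powr (- q + 1)))"
      using G q c by (simp add: ennreal_mult'[symmetric] E_def G_def mult_ac)
    finally show ?thesis
      using c q by (subst (asm) ennreal_le_iff) (auto simp: E_def)
  qed
  then show ?thesis unfolding q_def by blast
qed

section \<open>Moments and dilated densities\<close>

text \<open>Jensen's inequality for a concave power, obtained from Young's inequality
  \<open>y^p * m^(1-p) \<le> p * y + (1 - p) * m\<close> with \<open>m\<close> the mean of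
  \<open>Y\<close>. A vanishing mean is treated apart, as the last step divides by a power of
  \<open>m\<close>.\<close>

lemma (in prob_space) expectation_powr_le:
  fixes Y :: "'a \<Rightarrow> real" and p :: real
  assumes Y: "integrable M Y" "AE \<omega> in M. 0 \<le> Y \<omega>" and p: "0 < p" "p < 1"
  shows "integrable M (\<lambda>\<omega>. Y \<omega> powr p)"
    and "expectation (\<lambda>\<omega>. Y \<omega> powr p) \<le> expectation Y powr p"
proof -
  have [measurable]: "Y \<in> borel_measurable M" using Y by simp
  have young: "y powr p * m powr (1 - p) \<le> p * y + (1 - p) * m" if "0 \<le> y" "0 < m" for y m :: real
    using Youngs_inequality_0[of p "1 - p" y m] p that by (cases "y = 0") auto
  show int: "integrable M (\<lambda>\<omega>. Y \<omega> powr p)"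
  \<comment> \<open>Young's inequality with \<open>m = 1\<close> supplies the dominating
    function.\<close>
  proof (rule Bochner_Integration.integrable_bound)
    show "integrable M (\<lambda>\<omega>. p * Y \<omega> + (1 - p))" using Y by simp
    show "AE \<omega> in M. norm (Y \<omega> powr p) \<le> norm (p * Y \<omega> + (1 - p))"
      using Y(2) by eventually_elim (use young[of _ 1] p in auto)
  qed simp
  have nn: "0 \<le> expectation Y" using Y by (intro integral_nonneg_AE)
  show "expectation (\<lambda>\<omega>. Y \<omega> powr p) \<le> expectation Y powr p"
  proof (cases "expectation Y = 0")
    case True
    then have "AE \<omega> in M. Y \<omega> = 0"
      using integral_nonneg_eq_0_iff_AE[OF Y] by simp
    then have "AE \<omega> in M. Y \<omega> powr p = 0" by eventually_elim simp
    then have "expectation (\<lambda>\<omega>. Y \<omega> powr p) = expectation (\<lambda>_. 0)"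
      by (intro integral_cong_AE) auto
    then show ?thesis by simp
  next
    case False
    define m where "m = expectation Y"
    have m: "0 < m" using nn False by (simp add: m_def)
    have "expectation (\<lambda>\<omega>. Y \<omega> powr p) * m powr (1 - p) = expectation (\<lambda>\<omega>. Y \<omega> powr p * m powr (1 - p))"
      by simp
    also have "\<dots> \<le> expectation (\<lambda>\<omega>. p * Y \<omega> + (1 - p) * m)"
    proof (rule integral_mono_AE)
      show "AE \<omega> in M. Y \<omega> powr p * m powr (1 - p) \<le> p * Y \<omega> + (1 - p) * m"
        using Y(2) by eventually_elim (use young m in auto)
    qed (use int Y in auto)
    also have "\<dots> = m"
      using Y(1) by (simp add: prob_space m_def algebra_simps)
    also have "m = m powr p * m powr (1 - p)" using m by (simp add: powr_add[symmetric])
    finally show ?thesis using m by (simp add: m_def)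
  qed
qed

text \<open>The dilate \<open>f (u * (1 + b))\<close> has mass \<open>1 / (1 + b)\<close>, so the
  scaling condition bounds the missing mass \<open>b / (1 + b)\<close> by \<open>K0 * b\<close>.
  Normalising the dilate to a density costs once more this amount, hence the factor 2.\<close>

lemma density_dilation_L1:
  fixes f :: "real \<Rightarrow> real"
  assumes f: "integrable lborel f" "(\<integral>u. f u \<partial>lborel) = 1" "\<And>u. 0 \<le> f u" and b: "0 < b"
    and scale: "(\<integral>u. \<bar>f u - f (u * (1 + b))\<bar> \<partial>lborel) \<le> K0 * b"
  shows "b / (1 + b) \<le> K0 * b"
    and "integrable lborel (\<lambda>u. f (u * (1 + b)))"
    and "(\<integral>u. \<bar>f u - (1 + b) * f (u * (1 + b))\<bar> \<partial>lborel) \<le> 2 * K0 * b"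
proof -
  show int: "integrable lborel (\<lambda>u. f (u * (1 + b)))"
    using lborel_integrable_real_affine[OF f(1), of "1 + b" 0] b by (simp add: mult.commute)
  have I: "(\<integral>u. f (u * (1 + b)) \<partial>lborel) = 1 / (1 + b)"
    using lborel_integral_real_affine[of "1 + b" f 0] b f(2) by (simp add: mult.commute field_simps)
  have "b / (1 + b) = (\<integral>u. f u - f (u * (1 + b)) \<partial>lborel)"
    by (subst Bochner_Integration.integral_diff[OF f(1) int]) (use b in \<open>simp only: I f(2), simp add: field_simps\<close>)
  also have "\<dots> \<le> (\<integral>u. \<bar>f u - f (u * (1 + b))\<bar> \<partial>lborel)"
    using f int by (intro integral_mono) auto
  finally show *: "b / (1 + b) \<le> K0 * b" using scale by simp
  have "(\<integral>u. \<bar>f u - (1 + b) * f (u * (1 + b))\<bar> \<partial>lborel)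
      \<le> (\<integral>u. \<bar>f u - f (u * (1 + b))\<bar> + b * f (u * (1 + b)) \<partial>lborel)"
  proof (rule integral_mono)
    fix u
    have "\<bar>f u - (1 + b) * f (u * (1 + b))\<bar> = \<bar>(f u - f (u * (1 + b))) - b * f (u * (1 + b))\<bar>"
      by (simp add: algebra_simps)
    also have "\<dots> \<le> \<bar>f u - f (u * (1 + b))\<bar> + \<bar>b * f (u * (1 + b))\<bar>" by (rule abs_triangle_ineq4)
    finally show "\<bar>f u - (1 + b) * f (u * (1 + b))\<bar> \<le> \<bar>f u - f (u * (1 + b))\<bar> + b * f (u * (1 + b))"
      using b f(3) by simp
  qed (use f int in auto)
  also have "\<dots> = (\<integral>u. \<bar>f u - f (u * (1 + b))\<bar> \<partial>lborel) + b / (1 + b)"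
    using f int by (subst Bochner_Integration.integral_add) (auto simp: I)
  finally show "(\<integral>u. \<bar>f u - (1 + b) * f (u * (1 + b))\<bar> \<partial>lborel) \<le> 2 * K0 * b"
    using scale * by simp
qed

text \<open>A change of variables expresses both probabilities through the same set \<open>B\<close>
  at the same scale \<open>s\<close>. The difference is then that of two densities, controlled in
  L1.\<close>

lemma (in prob_space) prob_scaled_diff_le:
  fixes f :: "real \<Rightarrow> real"
  assumes D: "distributed M lborel Z (\<lambda>u. ennreal (f u))" and f: "\<And>u. 0 \<le> f u"
    and scale: "\<And>b. 0 < b \<Longrightarrow> (\<integral>u. \<bar>f u - f (u * (1 + b))\<bar> \<partial>lborel) \<le> K0 * b"
    and B: "B \<in> sets borel" and s: "0 < s'" "s' \<le> s"
  shows "\<bar>prob {\<omega>\<in>space M. Z \<omega> * s \<in> B} - prob {\<omega>\<in>space M. Z \<omega> * s' \<in> B}\<bar> \<le> 2 * K0 * ((s - s') / s')"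
proof (cases "s = s'")
  case False
  note [measurable] = B
  have [measurable]: "Z \<in> borel_measurable M" using distributed_measurable[OF D] by simp
  have [measurable]: "f \<in> borel_measurable borel"
    using distributed_real_measurable[OF _ D] f by simp
  have fint: "integrable lborel f" "(\<integral>u. f u \<partial>lborel) = 1"
    using distributed_integrable[OF D, of "\<lambda>_. 1"] distributed_integral[OF D, of "\<lambda>_. 1"] f prob_space by auto
  define b where "b = (s - s') / s'"
  have b: "0 < b" "s = s' * (1 + b)" using False s by (auto simp: b_def field_simps)
  note L1 = density_dilation_L1[OF fint f b(1) scale[OF b(1)]]
  have P: "prob {\<omega>\<in>space M. Z \<omega> * r \<in> B} = (\<integral>u. f u * indicator B (u * r) \<partial>lborel)" for r
  proof -
    have "prob {\<omega>\<in>space M. Z \<omega> * r \<in> B} = expectation (indicator {\<omega>\<in>space M. Z \<omega> * r \<in> B})"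
      by simp
    also have "\<dots> = expectation (\<lambda>\<omega>. indicator B (Z \<omega> * r))"
      by (rule Bochner_Integration.integral_cong) (auto split: split_indicator)
    also have "\<dots> = (\<integral>u. f u * indicator B (u * r) \<partial>lborel)"
      using distributed_integral[OF D, of "\<lambda>u. indicator B (u * r) :: real"] f by simp
    finally show ?thesis .
  qed
  have i1: "integrable lborel (\<lambda>u. f u * indicator B (u * s))"
    by (rule Bochner_Integration.integrable_bound[OF fint(1)]) (auto split: split_indicator)
  have i2: "integrable lborel (\<lambda>u. (1 + b) * f (u * (1 + b)) * indicator B (u * s))"
    by (rule Bochner_Integration.integrable_bound[OF integrable_mult_right[OF L1(2), of "1 + b"]])
      (auto split: split_indicator)
  \<comment> \<open>Substituting \<open>u * (1 + b)\<close> for \<open>u\<close> turns scale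
    \<open>s'\<close> into scale \<open>s = s' * (1 + b)\<close>.\<close>
  have "(\<integral>u. f u * indicator B (u * s') \<partial>lborel)
      = (\<integral>u. (1 + b) * f (u * (1 + b)) * indicator B (u * s) \<partial>lborel)"
    using lborel_integral_real_affine[of "1 + b" "\<lambda>u. f u * indicator B (u * s')" 0] b
    by (simp add: mult_ac)
  then have "\<bar>prob {\<omega>\<in>space M. Z \<omega> * s \<in> B} - prob {\<omega>\<in>space M. Z \<omega> * s' \<in> B}\<bar>
      = \<bar>\<integral>u. f u * indicator B (u * s) - (1 + b) * f (u * (1 + b)) * indicator B (u * s) \<partial>lborel\<bar>"
    using i1 i2 by (simp add: P)
  also have "\<dots> \<le> (\<integral>u. \<bar>f u * indicator B (u * s) - (1 + b) * f (u * (1 + b)) * indicator B (u * s)\<bar> \<partial>lborel)"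
    by (rule integral_abs_bound)
  also have "\<dots> \<le> (\<integral>u. \<bar>f u - (1 + b) * f (u * (1 + b))\<bar> \<partial>lborel)"
    using i1 i2 fint L1(2) by (intro integral_mono) (auto split: split_indicator)
  also have "\<dots> \<le> 2 * K0 * b" by (rule L1(3))
  finally show ?thesis by (simp add: b_def)
qed simp

text \<open>The argument produces the constant \<open>2 powr (\<nu> / (\<nu> + 1))\<close>, which is
  at most 2, and this bound lets \<open>K_nu\<close> absorb it.\<close>

lemma K_nu_ge:
  assumes "1 < \<nu>"
  shows "3 \<le> K_nu \<nu>"
proof -
  have "1 \<le> \<nu> powr (1 / (1 + \<nu>))" using assms by (intro ge_one_powr_ge_zero) auto
  then have "1 + 0 \<le> \<nu> powr (1 / (1 + \<nu>)) + \<nu> powr (- \<nu> / (\<nu> + 1))" by (intro add_mono) auto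
  then show ?thesis by (simp add: K_nu_def)
qed

text \<open>If some term reaches 1, its power alone is at least 1. Otherwise every term lies in
  [0, 1], where raising to a power \<open>p \<le> 1\<close> does not decrease it.\<close>

lemma min_one_suminf_le_powr:
  fixes y :: "nat \<Rightarrow> real" and S p :: real
  assumes y: "y sums S" "\<And>i. 0 \<le> y i" and p: "0 < p" "p \<le> 1"
  shows "ennreal (min 1 S) \<le> (\<Sum>i. ennreal (y i powr p))"
proof (cases "\<exists>i. 1 \<le> y i")
  case True
  then obtain i where "1 \<le> y i" by blast
  then have "1 \<le> y i powr p" using p by (intro ge_one_powr_ge_zero) auto
  then have "ennreal (min 1 S) \<le> ennreal (y i powr p)" by (intro ennreal_leI) simp
  also have "\<dots> = (\<Sum>j\<in>{i}. ennreal (y j powr p))" by simp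
  also have "\<dots> \<le> (\<Sum>i. ennreal (y i powr p))"
    by (rule sum_le_suminf) (rule summableI, simp_all)
  finally show ?thesis .
next
  case False
  have le: "y i \<le> y i powr p" for i
    using powr_mono'[OF p(2) y(2)[of i]] False y(2)[of i] by (simp add: not_le less_imp_le)
  have "ennreal (min 1 S) \<le> ennreal S" by (intro ennreal_leI) simp
  also have "\<dots> = (\<Sum>i. ennreal (y i))"
    using suminf_ennreal2[OF y(2) sums_summable[OF y(1)]] sums_unique[OF y(1)] by simp
  also have "\<dots> \<le> (\<Sum>i. ennreal (y i powr p))"
    by (rule suminf_le[OF ennreal_leI[OF le]]) (rule summableI)+
  finally show ?thesis .
qed

section \<open>Independence and sigma-algebras generated by a process\<close>

text \<open>Packaging the sigma-algebra as a measure space lets dependence on a block of variables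
  be expressed by \<open>measurable\<close>.\<close>

definition gen_alg :: "'a measure \<Rightarrow> (int \<Rightarrow> 'a \<Rightarrow> real) \<Rightarrow> int set \<Rightarrow> 'a measure" where
  "gen_alg M X T = sigma (space M) (generated_by M X T)"

lemma generated_by_subset_Pow: "generated_by M X T \<subseteq> Pow (space M)"
proof
  have sub: "(\<Union>t\<in>T. {X t -` B \<inter> space M |B. B \<in> sets borel}) \<subseteq> Pow (space M)" by auto
  show "A \<in> Pow (space M)" if "A \<in> generated_by M X T" for A
    using sigma_sets_into_sp[OF sub] that unfolding generated_by_def by blast
qed

lemma space_gen_alg [simp]: "space (gen_alg M X T) = space M"
  by (simp add: gen_alg_def space_measure_of_conv)

lemma sets_gen_alg: "sets (gen_alg M X T) = generated_by M X T"
  unfolding gen_alg_def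
  by (subst sets_measure_of[OF generated_by_subset_Pow])
    (unfold generated_by_def, rule sigma_sets_sigma_sets_eq, auto)

lemma measurable_gen_alg_component: "t \<in> T \<Longrightarrow> X t \<in> borel_measurable (gen_alg M X T)"
  by (rule measurableI) (auto simp: sets_gen_alg generated_by_def intro!: sigma_sets.Basic)

lemma generated_by_mono: "S \<subseteq> T \<Longrightarrow> generated_by M X S \<subseteq> generated_by M X T"
  unfolding generated_by_def by (intro sigma_sets_mono' UN_mono) auto

lemma measurable_gen_alg_mono:
  assumes "f \<in> measurable (gen_alg M X S) N" "S \<subseteq> T"
  shows "f \<in> measurable (gen_alg M X T) N"
  using assms generated_by_mono[OF assms(2), of M X]
  by (auto simp: measurable_def sets_gen_alg)

lemma generated_by_sets:
  assumes "\<And>t. X t \<in> borel_measurable M"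
  shows "generated_by M X T \<subseteq> sets M"
  unfolding generated_by_def
  by (rule sets.sigma_sets_subset) (use assms in \<open>auto intro: measurable_sets\<close>)

lemma measurable_gen_alg_imp:
  assumes "\<And>t. X t \<in> borel_measurable M" "f \<in> measurable (gen_alg M X T) N"
  shows "f \<in> measurable M N"
  using assms(2) generated_by_sets[where X = X and T = T, OF assms(1)] by (auto simp: measurable_def sets_gen_alg)

text \<open>Independence is first obtained for the sigma-algebras of the two disjoint blocks, by
  grouping an independent family of intersection-stable generators. It is then restricted to the
  smaller sigma-algebras of \<open>Y\<close> and \<open>W\<close>.\<close>

lemma (in prob_space) indep_var_gen_alg:
  assumes Z: "indep_vars (\<lambda>_. borel) Z UNIV" and ST: "S \<inter> T = {}"
    and Y: "Y \<in> measurable (gen_alg M Z S) N1" and W: "W \<in> measurable (gen_alg M Z T) N2"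
  shows "indep_var N1 Y N2 W"
proof -
  have Zm: "Z t \<in> borel_measurable M" for t using Z unfolding indep_vars_def2 by auto
  have "indep_sets (\<lambda>j. sigma_sets (space M) (\<Union>i\<in>case_bool S T j. {Z i -` A \<inter> space M |A. A \<in> sets borel})) UNIV"
  proof (rule indep_sets_collect_sigma)
    show "indep_sets (\<lambda>i. {Z i -` A \<inter> space M |A. A \<in> sets borel}) (\<Union>j\<in>UNIV. case_bool S T j)"
      using Z unfolding indep_vars_def2 by (auto intro: indep_sets_mono_index)
    show "disjoint_family_on (case_bool S T) UNIV"
      using ST by (auto simp: disjoint_family_on_def split: bool.split)
    show "Int_stable {Z i -` A \<inter> space M |A. A \<in> sets borel}" for i
      unfolding Int_stable_def
    proof safe
      fix A B :: "real set" assume "A \<in> sets borel" "B \<in> sets borel"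
      then show "\<exists>C. Z i -` A \<inter> space M \<inter> (Z i -` B \<inter> space M) = Z i -` C \<inter> space M \<and> C \<in> sets borel"
        by (intro exI[of _ "A \<inter> B"]) auto
    qed
  qed
  then have "indep_set (generated_by M Z S) (generated_by M Z T)"
    unfolding indep_set_def generated_by_def
    by (rule indep_sets_mono_sets) (auto split: bool.split)
  then have ind: "prob (A \<inter> B) = prob A * prob B"
    if "A \<in> generated_by M Z S" "B \<in> generated_by M Z T" for A B
    using that by (rule indep_setD)
  have sub: "sigma_sets (space M) {f -` A \<inter> space M |A. A \<in> sets N} \<subseteq> generated_by M Z U"
    if "f \<in> measurable (gen_alg M Z U) N" for f N U
  proof -
    have "sigma_sets (space (gen_alg M Z U)) {f -` A \<inter> space M |A. A \<in> sets N} \<subseteq> sets (gen_alg M Z U)"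
      using measurable_sets[OF that] by (intro sets.sigma_sets_subset) auto
    then show ?thesis by (simp add: sets_gen_alg)
  qed
  show ?thesis
    unfolding indep_var_eq indep_sets2_eq
  proof (intro conjI ballI)
    show "random_variable N1 Y" "random_variable N2 W"
      by (rule measurable_gen_alg_imp[OF Zm Y], rule measurable_gen_alg_imp[OF Zm W])
    show "sigma_sets (space M) {Y -` A \<inter> space M |A. A \<in> sets N1} \<subseteq> events"
      "sigma_sets (space M) {W -` A \<inter> space M |A. A \<in> sets N2} \<subseteq> events"
      by (rule order_trans[OF sub[OF Y] generated_by_sets[OF Zm]],
          rule order_trans[OF sub[OF W] generated_by_sets[OF Zm]])
    show "prob (A \<inter> B) = prob A * prob B"
      if "A \<in> sigma_sets (space M) {Y -` A \<inter> space M |A. A \<in> sets N1}"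
        "B \<in> sigma_sets (space M) {W -` A \<inter> space M |A. A \<in> sets N2}" for A B
      by (rule ind[OF subsetD[OF sub[OF Y] that(1)] subsetD[OF sub[OF W] that(2)]])
  qed
qed

text \<open>The joint law is the product of the marginals, so Tonelli's theorem applies. This later
  freezes the volatility while the innovation is integrated out.\<close>

lemma (in prob_space) indep_var_nn_integral_pair:
  assumes ind: "indep_var S Y T W" and h [measurable]: "h \<in> borel_measurable (S \<Otimes>\<^sub>M T)"
  shows "(\<integral>\<^sup>+\<omega>. h (Y \<omega>, W \<omega>) \<partial>M) = (\<integral>\<^sup>+\<omega>. (\<integral>\<^sup>+\<omega>'. h (Y \<omega>, W \<omega>') \<partial>M) \<partial>M)"
proof -
  have [measurable]: "Y \<in> measurable M S" "W \<in> measurable M T"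
    using ind unfolding indep_var_distribution_eq by auto
  interpret W: prob_space "distr M T W" by (rule prob_space_distr) simp
  have "(\<integral>\<^sup>+\<omega>. h (Y \<omega>, W \<omega>) \<partial>M) = (\<integral>\<^sup>+x. h x \<partial>distr M (S \<Otimes>\<^sub>M T) (\<lambda>\<omega>. (Y \<omega>, W \<omega>)))"
    by (simp add: nn_integral_distr)
  also have "distr M (S \<Otimes>\<^sub>M T) (\<lambda>\<omega>. (Y \<omega>, W \<omega>)) = distr M S Y \<Otimes>\<^sub>M distr M T W"
    using ind unfolding indep_var_distribution_eq by simp
  also have "(\<integral>\<^sup>+x. h x \<partial>(distr M S Y \<Otimes>\<^sub>M distr M T W))
      = (\<integral>\<^sup>+y. (\<integral>\<^sup>+w. h (y, w) \<partial>distr M T W) \<partial>distr M S Y)"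
    by (subst W.nn_integral_fst[symmetric]) (simp_all cong: measurable_cong_sets)
  also have "\<dots> = (\<integral>\<^sup>+\<omega>. (\<integral>\<^sup>+\<omega>'. h (Y \<omega>, W \<omega>') \<partial>M) \<partial>M)"
    by (subst nn_integral_distr) (auto intro!: nn_integral_cong simp: nn_integral_distr measurable_space)
  finally show ?thesis .
qed

lemma (in prob_space) indep_var_nn_integral_mult:
  fixes Y W :: "'a \<Rightarrow> ennreal"
  assumes "indep_var borel Y borel W"
  shows "(\<integral>\<^sup>+\<omega>. Y \<omega> * W \<omega> \<partial>M) = (\<integral>\<^sup>+\<omega>. Y \<omega> \<partial>M) * (\<integral>\<^sup>+\<omega>. W \<omega> \<partial>M)"
proof -
  have [measurable]: "Y \<in> borel_measurable M" "W \<in> borel_measurable M"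
    using assms unfolding indep_var_distribution_eq by auto
  show ?thesis
    using indep_var_nn_integral_pair[OF assms, of "\<lambda>(y, w). y * w"]
    by (simp add: nn_integral_cmult nn_integral_multc)
qed

text \<open>The events having an almost surely equal partner contain the generating preimages and
  are closed under complement and countable union. This moves events of \<open>X\<close> to a
  version that is a function of the innovations.\<close>

lemma AE_eq_generated_by:
  assumes XY: "\<And>t. t \<in> T \<Longrightarrow> AE \<omega> in M. X t \<omega> = Y t \<omega>"
    and H: "H \<in> generated_by M X T"
  shows "\<exists>H'\<in>generated_by M Y T. AE \<omega> in M. \<omega> \<in> H \<longleftrightarrow> \<omega> \<in> H'"
  using H unfolding generated_by_def[of M X]
proof (induction rule: sigma_sets.induct)
  case (Basic H)
  then obtain t B where t: "t \<in> T" "B \<in> sets borel" "H = X t -` B \<inter> space M" by auto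
  show ?case
  proof (intro bexI)
    show "Y t -` B \<inter> space M \<in> generated_by M Y T"
      using t unfolding generated_by_def by (auto intro!: sigma_sets.Basic)
    show "AE \<omega> in M. \<omega> \<in> H \<longleftrightarrow> \<omega> \<in> Y t -` B \<inter> space M"
      using XY[OF t(1)] by eventually_elim (simp add: t(3))
  qed
next
  case Empty
  then show ?case by (intro bexI[of _ "{}"]) (auto simp: generated_by_def intro: sigma_sets.Empty)
next
  case (Compl H)
  then obtain H' where H': "H' \<in> generated_by M Y T" "AE \<omega> in M. \<omega> \<in> H \<longleftrightarrow> \<omega> \<in> H'" by blast
  show ?case
  proof (intro bexI)
    show "space M - H' \<in> generated_by M Y T"
      using H'(1) unfolding generated_by_def by (rule sigma_sets.Compl)
    show "AE \<omega> in M. \<omega> \<in> space M - H \<longleftrightarrow> \<omega> \<in> space M - H'"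
      using H'(2) by eventually_elim simp
  qed
next
  case (Union H)
  then obtain H' where H': "\<And>i. H' i \<in> generated_by M Y T" "\<And>i. AE \<omega> in M. \<omega> \<in> H i \<longleftrightarrow> \<omega> \<in> H' i"
    by metis
  show ?case
  proof (intro bexI)
    show "(\<Union>i. H' i) \<in> generated_by M Y T"
      using H'(1) unfolding generated_by_def by (rule sigma_sets.Union)
    have "AE \<omega> in M. \<forall>i. \<omega> \<in> H i \<longleftrightarrow> \<omega> \<in> H' i" using H'(2) by (simp add: AE_all_countable)
    then show "AE \<omega> in M. \<omega> \<in> (\<Union>i. H i) \<longleftrightarrow> \<omega> \<in> (\<Union>i. H' i)"
      by eventually_elim simp
  qed
qed

text \<open>The preimages under a single variable already form a sigma-algebra.\<close>

lemma generated_by_singleton: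
  assumes "G \<in> generated_by M X {t}"
  obtains B where "B \<in> sets borel" "G = X t -` B \<inter> space M"
proof -
  have "{X t -` B \<inter> space M |B. B \<in> sets borel} = sets (vimage_algebra (space M) (X t) borel)"
    by (subst sets_vimage_algebra2) auto
  then have "sigma_sets (space M) {X t -` B \<inter> space M |B. B \<in> sets borel} = {X t -` B \<inter> space M |B. B \<in> sets borel}"
    by (metis sets.sigma_sets_eq space_vimage_algebra)
  then show thesis using assms that by (auto simp: generated_by_def)
qed

lemma generated_by_subset:
  assumes "\<And>t. t \<in> T \<Longrightarrow> Y t \<in> borel_measurable (gen_alg M Z S)"
  shows "generated_by M Y T \<subseteq> generated_by M Z S"
proof -
  have "(\<Union>t\<in>T. {Y t -` B \<inter> space M |B. B \<in> sets borel}) \<subseteq> sets (gen_alg M Z S)"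
    using measurable_sets[OF assms] by auto
  from sets.sigma_sets_subset[OF this] show ?thesis
    by (simp add: sets_gen_alg generated_by_def[of M Y])
qed

section \<open>Bounds for mixing coefficients\<close>

lemma (in prob_space) mixing_coeff_le:
  assumes bound: "\<And>G H. G \<in> \<A> \<Longrightarrow> H \<in> \<B> \<Longrightarrow> ennreal \<bar>prob (G \<inter> H) - prob G * prob H\<bar> \<le> R"
    and ne: "{} \<in> \<A>" "{} \<in> \<B>"
  shows "ennreal (mixing_coeff M \<A> \<B>) \<le> R"
proof (cases R)
  case (real r)
  have "mixing_coeff M \<A> \<B> \<le> r"
    unfolding mixing_coeff_def
  proof (rule cSUP_least)
    show "\<A> \<times> \<B> \<noteq> {}" using ne by auto
    show "(case x of (G, H) \<Rightarrow> \<bar>prob (G \<inter> H) - prob G * prob H\<bar>) \<le> r" if "x \<in> \<A> \<times> \<B>" for x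
      using that bound real by (auto split: prod.split)
  qed
  then show ?thesis using real by (simp add: ennreal_leI)
qed simp

lemma empty_in_generated_by: "{} \<in> generated_by M X T"
  unfolding generated_by_def by (rule sigma_sets.Empty)

lemma (in prob_space) mixing_coeff_le_one: "mixing_coeff M (generated_by M X S) (generated_by M X T) \<le> 1"
proof -
  have "ennreal (mixing_coeff M (generated_by M X S) (generated_by M X T)) \<le> ennreal 1"
  proof (rule mixing_coeff_le[OF _ empty_in_generated_by empty_in_generated_by])
    fix G H
    have "prob G * prob H \<le> 1" by (intro mult_le_one) auto
    moreover have "0 \<le> prob G * prob H" "0 \<le> prob (G \<inter> H)" "prob (G \<inter> H) \<le> 1" by simp_all
    ultimately show "ennreal \<bar>prob (G \<inter> H) - prob G * prob H\<bar> \<le> ennreal 1"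
      by (intro ennreal_leI) (simp only: abs_le_iff, linarith)
  qed
  then show ?thesis by (subst (asm) ennreal_le_iff) simp_all
qed

text \<open>Partial sums are dominated by those of the positive parts. The signed series may
  converge only conditionally, so the right-hand side may be infinite.\<close>

lemma ennreal_sums_le:
  fixes y :: "nat \<Rightarrow> real"
  assumes "y sums S"
  shows "ennreal S \<le> (\<Sum>i. ennreal (max 0 (y i)))"
proof (rule LIMSEQ_le_const2)
  show "(\<lambda>n. ennreal (\<Sum>i<n. y i)) \<longlonglongrightarrow> ennreal S"
    using assms unfolding sums_def by (rule tendsto_ennrealI)
  have "ennreal (\<Sum>i<n. y i) \<le> (\<Sum>i. ennreal (max 0 (y i)))" for n
  proof -
    have "ennreal (\<Sum>i<n. y i) \<le> ennreal (\<Sum>i<n. max 0 (y i))"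
      by (intro ennreal_leI sum_mono) simp
    also have "\<dots> = (\<Sum>i<n. ennreal (max 0 (y i)))" by (subst sum_ennreal) auto
    also have "\<dots> \<le> (\<Sum>i. ennreal (max 0 (y i)))"
      by (rule sum_le_suminf) (rule summableI, simp_all)
    finally show ?thesis .
  qed
  then show "\<exists>N. \<forall>n\<ge>N. ennreal (\<Sum>i<n. y i) \<le> (\<Sum>i. ennreal (max 0 (y i)))" by blast
qed

lemma volterra_measurable:
  assumes "1 \<le> k"
  shows "(\<lambda>\<omega>. volterra a (\<lambda>s. Z (int s) \<omega>) b k) \<in> borel_measurable (gen_alg M Z {1..<int k})"
  using assms
proof (induction k rule: less_induct)
  case (less k)
  have "(\<lambda>\<omega>. b k + (\<Sum>s\<in>{1..<k}. a (k - s) * Z (int s) \<omega> * volterra a (\<lambda>s. Z (int s) \<omega>) b s))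
      \<in> borel_measurable (gen_alg M Z {1..<int k})"
  proof (intro borel_measurable_add borel_measurable_sum borel_measurable_times borel_measurable_const)
    fix s assume s: "s \<in> {1..<k}"
    show "Z (int s) \<in> borel_measurable (gen_alg M Z {1..<int k})"
      using s by (intro measurable_gen_alg_component) auto
    show "(\<lambda>\<omega>. volterra a (\<lambda>s. Z (int s) \<omega>) b s) \<in> borel_measurable (gen_alg M Z {1..<int k})"
      by (rule measurable_gen_alg_mono[OF less.IH]) (use s in auto)
  qed
  then show ?case by (simp only: volterra.simps[of a _ b k])
qed

section \<open>The stationary ARCH process\<close>

locale arch_process = prob_space M for M :: "'a measure" +
  fixes X Z :: "int \<Rightarrow> 'a \<Rightarrow> real"
    and f :: "real \<Rightarrow> real"
    and a \<psi> :: "nat \<Rightarrow> real"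
    and \<nu> \<delta>0 K0 :: real
  assumes Z_indep: "indep_vars (\<lambda>_. borel) Z UNIV"
    and Z_density: "\<And>t. distributed M lborel (Z t) (\<lambda>u. ennreal (f u))"
    and f_nonneg: "\<And>u. 0 \<le> f u"
    and Z_pos: "\<And>t. AE \<omega> in M. 0 < Z t \<omega>"
    and Z_mean: "\<And>t. integrable M (Z t)" "\<And>t. expectation (Z t) = 1"
    and a_pos: "\<And>j. 0 < a j"
    and \<delta>0: "0 < \<delta>0"
    and a_sum: "summable (\<lambda>j. a (Suc j))" "(\<Sum>j. a (Suc j)) < 1 - \<delta>0"
    and X_arch: "arch_infinity M a Z X"
    and \<nu>: "1 < \<nu>"
    and X_moment: "\<And>t. integrable M (\<lambda>\<omega>. \<bar>X t \<omega>\<bar> powr \<nu>)"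
    and f_scale: "\<And>b. 0 < b \<Longrightarrow> (\<integral>u. \<bar>f u - f (u * (1 + b))\<bar> \<partial>lborel) \<le> K0 * b"
    and \<psi>: "\<And>z :: complex. norm z \<le> 1 \<Longrightarrow>
        (\<lambda>j. of_real (\<psi> j) * z ^ j) sums
          inverse (1 - (\<Sum>j. of_real (a (Suc j)) * z ^ Suc j))"
begin

lemma Z_measurable [measurable]: "Z t \<in> borel_measurable M"
  using Z_indep unfolding indep_vars_def2 by auto

lemma X_measurable [measurable]: "X t \<in> borel_measurable M"
  using X_arch unfolding arch_infinity_def strictly_stationary_def by auto

text \<open>A version of \<open>X t\<close> that is a function of the innovations up to time \<open>t\<close> everywhere,
  not just almost surely.\<close>

definition X\<^sub>c :: "int \<Rightarrow> 'a \<Rightarrow> real" where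
  "X\<^sub>c t = (SOME Y. Y \<in> borel_measurable (gen_alg M Z {..t}) \<and> (AE \<omega> in M. X t \<omega> = Y \<omega>))"

lemma X\<^sub>c: "X\<^sub>c t \<in> borel_measurable (gen_alg M Z {..t})" "AE \<omega> in M. X t \<omega> = X\<^sub>c t \<omega>"
proof -
  obtain g where g: "g \<in> borel_measurable (\<Pi>\<^sub>M n\<in>(UNIV :: nat set). (borel :: real measure))"
    "AE \<omega> in M. X t \<omega> = g (\<lambda>n. Z (t - int n) \<omega>)"
    using X_arch unfolding arch_infinity_def causal_in_def by blast
  have "(\<lambda>\<omega> n. Z (t - int n) \<omega>) \<in> measurable (gen_alg M Z {..t}) (\<Pi>\<^sub>M n\<in>(UNIV :: nat set). (borel :: real measure))"
    by (rule measurable_PiM_single') (auto intro: measurable_gen_alg_component)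
  from measurable_compose[OF this g(1)] g(2)
  have "\<exists>Y. Y \<in> borel_measurable (gen_alg M Z {..t}) \<and> (AE \<omega> in M. X t \<omega> = Y \<omega>)"
    by blast
  from someI_ex[OF this] show "X\<^sub>c t \<in> borel_measurable (gen_alg M Z {..t})" "AE \<omega> in M. X t \<omega> = X\<^sub>c t \<omega>"
    unfolding X\<^sub>c_def by auto
qed

lemma X\<^sub>c_measurable [measurable]: "X\<^sub>c t \<in> borel_measurable M"
  by (rule measurable_gen_alg_imp[OF Z_measurable X\<^sub>c(1)])

text \<open>The one-time law is the image of the law of the shifted path under evaluation at
  0.\<close>

lemma distr_X: "distr M borel (X t) = distr M borel (X 0)"
proof -
  have *: "distr M borel (X t) = distr (distr M (\<Pi>\<^sub>M t\<in>UNIV. borel) (\<lambda>\<omega> s. X (s + t) \<omega>)) borel (\<lambda>x. x 0)" for t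
  proof -
    have "(\<lambda>\<omega> s. X (s + t) \<omega>) \<in> measurable M (\<Pi>\<^sub>M t\<in>UNIV. borel)"
      by (rule measurable_PiM_single') auto
    then show ?thesis by (subst distr_distr) (auto simp: o_def)
  qed
  show ?thesis
    using X_arch unfolding arch_infinity_def strictly_stationary_def *[of t] *[of 0] by simp
qed

lemma nn_integral_X:
  "h \<in> borel_measurable borel \<Longrightarrow> (\<integral>\<^sup>+\<omega>. h (X t \<omega>) \<partial>M) = (\<integral>\<^sup>+\<omega>. h (X 0 \<omega>) \<partial>M)"
  using nn_integral_distr[of "X t" M borel h] nn_integral_distr[of "X 0" M borel h] distr_X[of t]
  by simp

lemma expectation_X:
  fixes h :: "real \<Rightarrow> real"
  shows "h \<in> borel_measurable borel \<Longrightarrow> expectation (\<lambda>\<omega>. h (X t \<omega>)) = expectation (\<lambda>\<omega>. h (X 0 \<omega>))"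
  using integral_distr[of "X t" M borel h] integral_distr[of "X 0" M borel h] distr_X[of t]
  by simp

text \<open>Using \<open>X\<^sub>c\<close> instead of \<open>X\<close> makes \<open>vol t\<close> a
  function of the innovations strictly before \<open>t\<close> at every sample point, hence
  independent of \<open>Z t\<close>.\<close>

definition vol :: "int \<Rightarrow> 'a \<Rightarrow> real" where
  "vol t \<omega> = a 0 + (\<Sum>j. a (Suc j) * X\<^sub>c (t - int (Suc j)) \<omega>)"

lemma vol_measurable_gen: "vol t \<in> borel_measurable (gen_alg M Z {..<t})"
proof -
  have [measurable]: "X\<^sub>c (t - int (Suc j)) \<in> borel_measurable (gen_alg M Z {..<t})" for j
    by (rule measurable_gen_alg_mono[OF X\<^sub>c(1)]) auto
  show ?thesis unfolding vol_def[abs_def] by measurable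
qed

lemma vol_measurable [measurable]: "vol t \<in> borel_measurable M"
  by (rule measurable_gen_alg_imp[OF Z_measurable vol_measurable_gen])

text \<open>Time is countable, so a single null set serves all \<open>t\<close> at once.\<close>

lemma AE_recursion:
  "AE \<omega> in M. \<forall>t. X t \<omega> = X\<^sub>c t \<omega> \<and> 0 < Z t \<omega> \<and>
     summable (\<lambda>j. a (Suc j) * X (t - int (Suc j)) \<omega>) \<and> X t \<omega> = Z t \<omega> * vol t \<omega>"
proof -
  have "AE \<omega> in M. \<forall>t. X t \<omega> = X\<^sub>c t \<omega>" "AE \<omega> in M. \<forall>t. 0 < Z t \<omega>"
    using X\<^sub>c(2) Z_pos by (auto simp: AE_all_countable)
  moreover have "AE \<omega> in M. \<forall>t. summable (\<lambda>j. a (Suc j) * X (t - int (Suc j)) \<omega>) \<and>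
      X t \<omega> = Z t \<omega> * (a 0 + (\<Sum>j. a (Suc j) * X (t - int (Suc j)) \<omega>))"
    using X_arch unfolding arch_infinity_def AE_all_countable by blast
  ultimately show ?thesis
  proof eventually_elim
    case (elim \<omega>)
    have Xc: "X\<^sub>c t \<omega> = X t \<omega>" for t using elim(1) by simp
    have vol: "vol t \<omega> = a 0 + (\<Sum>j. a (Suc j) * X (t - int (Suc j)) \<omega>)" for t
      by (simp only: vol_def Xc)
    show ?case
      unfolding vol Xc using elim(2,3) by blast
  qed
qed

section \<open>Integrability and sign of the process\<close>

lemma X_integrable: "integrable M (X t)"
proof (rule Bochner_Integration.integrable_bound)
  show "integrable M (\<lambda>\<omega>. 1 + \<bar>X t \<omega>\<bar> powr \<nu>)" using X_moment by simp
  have "\<bar>x\<bar> \<le> 1 + \<bar>x\<bar> powr \<nu>" for x :: real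
  proof (cases "\<bar>x\<bar> \<le> 1")
    case False then show ?thesis using powr_mono[of 1 \<nu> "\<bar>x\<bar>"] \<nu> by simp
  qed (simp add: add_increasing2)
  then show "AE \<omega> in M. norm (X t \<omega>) \<le> norm (1 + \<bar>X t \<omega>\<bar> powr \<nu>)" by simp
qed simp

text \<open>The negative part satisfies \<open>X\<^sup>-(t) \<le> Z(t) \<Sum> a(j) X\<^sup>-(t - j)\<close>, so its mean, which is
  the same for all \<open>t\<close>, is at most \<open>\<Sum> a(j) < 1\<close> times itself.\<close>

lemma X_nonneg: "AE \<omega> in M. 0 \<le> X t \<omega>"
proof -
  define N where "N = (\<integral>\<^sup>+\<omega>. ennreal (max 0 (- X 0 \<omega>)) \<partial>M)"
  define s where "s = (\<Sum>j. a (Suc j))"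
  have s: "0 \<le> s" "s < 1"
    using suminf_nonneg[OF a_sum(1) less_imp_le[OF a_pos]] a_sum(2) \<delta>0 by (simp_all add: s_def)
  have N: "(\<integral>\<^sup>+\<omega>. ennreal (max 0 (- X t \<omega>)) \<partial>M) = N" for t
    unfolding N_def by (rule nn_integral_X[of "\<lambda>x. ennreal (max 0 (- x))"]) measurable
  have Nc: "(\<integral>\<^sup>+\<omega>. ennreal (max 0 (- X\<^sub>c t \<omega>)) \<partial>M) = N" for t
  proof -
    have "AE \<omega> in M. ennreal (max 0 (- X\<^sub>c t \<omega>)) = ennreal (max 0 (- X t \<omega>))"
      using X\<^sub>c(2)[of t] by eventually_elim simp
    then show ?thesis unfolding N[of t, symmetric] by (rule nn_integral_cong_AE)
  qed
  \<comment> \<open>The series is taken in the extended nonnegative reals because summability of the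
    negative parts is not yet known.\<close>
  define R where "R \<omega> = (\<Sum>j. ennreal (a (Suc j)) * ennreal (max 0 (- X\<^sub>c (t - int (Suc j)) \<omega>)))" for \<omega>
  have "AE \<omega> in M. ennreal (max 0 (- X t \<omega>)) \<le> ennreal (Z t \<omega>) * R \<omega>"
    using AE_recursion
  proof eventually_elim
    case (elim \<omega>)
    define S where "S = (\<Sum>j. a (Suc j) * X (t - int (Suc j)) \<omega>)"
    have sm: "(\<lambda>j. - (a (Suc j) * X (t - int (Suc j)) \<omega>)) sums (- S)"
      using elim unfolding S_def by (intro sums_minus summable_sums) blast
    have Xc: "X\<^sub>c t \<omega> = X t \<omega>" for t using elim by simp
    have Z: "0 < Z t \<omega>" and "X t \<omega> = Z t \<omega> * vol t \<omega>" using elim by blast+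
    then have X: "X t \<omega> = Z t \<omega> * (a 0 + S)" by (simp only: vol_def S_def Xc)
    have summand: "ennreal (max 0 (- (a (Suc j) * X (t - int (Suc j)) \<omega>)))
        = ennreal (a (Suc j)) * ennreal (max 0 (- X\<^sub>c (t - int (Suc j)) \<omega>))" for j
      unfolding Xc using a_pos[of "Suc j"]
      by (subst ennreal_mult[symmetric]) (auto simp: max_def mult_le_0_iff zero_le_mult_iff)
    have "ennreal (- S) \<le> (\<Sum>j. ennreal (max 0 (- (a (Suc j) * X (t - int (Suc j)) \<omega>))))"
      by (rule ennreal_sums_le[OF sm])
    also have "\<dots> = R \<omega>" unfolding R_def summand ..
    finally have SR: "ennreal (- S) \<le> R \<omega>" .
    \<comment> \<open>The positive term \<open>Z t * a 0\<close> is dropped.\<close>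
    have "max 0 (- X t \<omega>) \<le> max 0 (Z t \<omega> * (- S))"
    proof (rule max.mono)
      show "- X t \<omega> \<le> Z t \<omega> * (- S)" using Z a_pos[of 0] by (simp add: X algebra_simps)
    qed simp
    then have "ennreal (max 0 (- X t \<omega>)) \<le> ennreal (max 0 (Z t \<omega> * (- S)))" by (rule ennreal_leI)
    also have "\<dots> = ennreal (Z t \<omega> * (- S))"
      by (cases "0 \<le> Z t \<omega> * (- S)") (auto simp: max_def ennreal_neg)
    also have "\<dots> = ennreal (Z t \<omega>) * ennreal (- S)"
      using Z by (intro ennreal_mult') simp
    also have "\<dots> \<le> ennreal (Z t \<omega>) * R \<omega>" using SR by (rule mult_left_mono) simp
    finally show ?case .
  qed
  then have "(\<integral>\<^sup>+\<omega>. ennreal (max 0 (- X t \<omega>)) \<partial>M) \<le> (\<integral>\<^sup>+\<omega>. ennreal (Z t \<omega>) * R \<omega> \<partial>M)"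
    by (rule nn_integral_mono_AE)
  \<comment> \<open>\<open>R\<close> depends only on innovations before \<open>t\<close>, so it is
    independent of \<open>Z t\<close>.\<close>
  also have "\<dots> = (\<integral>\<^sup>+\<omega>. ennreal (Z t \<omega>) \<partial>M) * (\<integral>\<^sup>+\<omega>. R \<omega> \<partial>M)"
  proof (rule indep_var_nn_integral_mult, rule indep_var_gen_alg[OF Z_indep])
    have [measurable]: "Z t \<in> borel_measurable (gen_alg M Z {t})"
      by (rule measurable_gen_alg_component) simp
    show "(\<lambda>\<omega>. ennreal (Z t \<omega>)) \<in> borel_measurable (gen_alg M Z {t})" by measurable
    have [measurable]: "X\<^sub>c (t - int (Suc j)) \<in> borel_measurable (gen_alg M Z {..<t})" for j
      by (rule measurable_gen_alg_mono[OF X\<^sub>c(1)]) auto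
    show "R \<in> borel_measurable (gen_alg M Z {..<t})" unfolding R_def[abs_def] by measurable
  qed auto
  also have "(\<integral>\<^sup>+\<omega>. ennreal (Z t \<omega>) \<partial>M) = 1"
    using Z_mean[of t] Z_pos[of t] by (subst nn_integral_eq_integral) (auto elim: eventually_mono)
  also have "(\<integral>\<^sup>+\<omega>. R \<omega> \<partial>M) = (\<Sum>j. ennreal (a (Suc j)) * N)"
  proof -
    have "(\<integral>\<^sup>+\<omega>. ennreal (a (Suc j)) * ennreal (max 0 (- X\<^sub>c (t - int (Suc j)) \<omega>)) \<partial>M) = ennreal (a (Suc j)) * N" for j
      by (subst nn_integral_cmult) (measurable, simp only: Nc)
    then show ?thesis unfolding R_def by (subst nn_integral_suminf) simp_all
  qed
  also have "\<dots> = ennreal s * N"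
    unfolding s_def using a_sum(1) a_pos by (subst suminf_ennreal2[symmetric]) (auto simp: less_imp_le ennreal_suminf_multc)
  finally have le: "N \<le> ennreal s * N" by (simp only: N mult_1)
  \<comment> \<open>Finiteness of \<open>N\<close> is essential: an infinite mean would satisfy
    \<open>N \<le> s * N\<close> when \<open>s\<close> is positive.\<close>
  have "integrable M (\<lambda>\<omega>. max 0 (- X 0 \<omega>))"
    using X_integrable by (intro integrable_max) auto
  then have Nfin: "N = ennreal (expectation (\<lambda>\<omega>. max 0 (- X 0 \<omega>)))"
    unfolding N_def by (intro nn_integral_eq_integral) auto
  define n where "n = expectation (\<lambda>\<omega>. max 0 (- X 0 \<omega>))"
  have n: "0 \<le> n" by (simp add: n_def)
  have "n \<le> s * n"
    using le n s unfolding Nfin n_def[symmetric] by (simp add: ennreal_mult[symmetric])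
  then have "(1 - s) * n \<le> 0" by (simp add: algebra_simps)
  then have "n = 0" using s n by (simp add: mult_le_0_iff)
  then have "(\<integral>\<^sup>+\<omega>. ennreal (max 0 (- X t \<omega>)) \<partial>M) = 0" using N[of t] Nfin by (simp only: n_def ennreal_0)
  then have "AE \<omega> in M. ennreal (max 0 (- X t \<omega>)) = 0" by (subst (asm) nn_integral_0_iff_AE) auto
  then show ?thesis by eventually_elim (simp add: max_def split: if_splits)
qed

section \<open>Dependence of the volatility on the past\<close>

text \<open>The value at time \<open>s\<close> involves only innovations before \<open>s\<close>, so
  it is independent of \<open>Z s\<close>. As \<open>Z s\<close> has mean 1, taking means replaces
  every innovation by 1.\<close>

lemma volterra_integrable:
  assumes "1 \<le> k"
  shows "integrable M (\<lambda>\<omega>. volterra a (\<lambda>s. Z (int s) \<omega>) b k) \<and>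
    expectation (\<lambda>\<omega>. volterra a (\<lambda>s. Z (int s) \<omega>) b k) = volterra a (\<lambda>_. 1) b k"
  using assms
proof (induction k rule: less_induct)
  case (less k)
  have step: "integrable M (\<lambda>\<omega>. Z (int s) \<omega> * volterra a (\<lambda>s. Z (int s) \<omega>) b s) \<and>
      expectation (\<lambda>\<omega>. Z (int s) \<omega> * volterra a (\<lambda>s. Z (int s) \<omega>) b s) = volterra a (\<lambda>_. 1) b s"
    if s: "s \<in> {1..<k}" for s
  proof -
    have ind: "indep_var borel (Z (int s)) borel (\<lambda>\<omega>. volterra a (\<lambda>s. Z (int s) \<omega>) b s)"
      by (rule indep_var_gen_alg[OF Z_indep _ measurable_gen_alg_component volterra_measurable,
          where S = "{int s}"]) (use s in auto)
    have IH: "integrable M (\<lambda>\<omega>. volterra a (\<lambda>s. Z (int s) \<omega>) b s)"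
      "expectation (\<lambda>\<omega>. volterra a (\<lambda>s. Z (int s) \<omega>) b s) = volterra a (\<lambda>_. 1) b s"
      using less.IH[of s] s by auto
    show ?thesis
      using indep_var_integrable[OF ind Z_mean(1) IH(1)] indep_var_lebesgue_integral[OF ind Z_mean(1) IH(1)]
      by (simp only: IH(2) Z_mean(2) mult_1 simp_thms)
  qed
  have eq: "(\<lambda>\<omega>. volterra a (\<lambda>s. Z (int s) \<omega>) b k)
      = (\<lambda>\<omega>. b k + (\<Sum>s\<in>{1..<k}. a (k - s) * (Z (int s) \<omega> * volterra a (\<lambda>s. Z (int s) \<omega>) b s)))"
    by (simp only: volterra.simps[of a _ b k] mult.assoc)
  have int: "integrable M (\<lambda>\<omega>. \<Sum>s\<in>{1..<k}. a (k - s) * (Z (int s) \<omega> * volterra a (\<lambda>s. Z (int s) \<omega>) b s))"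
    using step by (intro Bochner_Integration.integrable_sum integrable_mult_right) blast
  have "expectation (\<lambda>\<omega>. volterra a (\<lambda>s. Z (int s) \<omega>) b k)
      = b k + expectation (\<lambda>\<omega>. \<Sum>s\<in>{1..<k}. a (k - s) * (Z (int s) \<omega> * volterra a (\<lambda>s. Z (int s) \<omega>) b s))"
    unfolding eq using int by (subst Bochner_Integration.integral_add) (simp_all add: prob_space)
  also have "expectation (\<lambda>\<omega>. \<Sum>s\<in>{1..<k}. a (k - s) * (Z (int s) \<omega> * volterra a (\<lambda>s. Z (int s) \<omega>) b s))
      = (\<Sum>s\<in>{1..<k}. a (k - s) * 1 * volterra a (\<lambda>_. 1) b s)"
    using step by (subst Bochner_Integration.integral_sum) (auto intro!: sum.cong)
  also have "b k + \<dots> = volterra a (\<lambda>_. 1) b k" by (rule volterra.simps[symmetric])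
  finally show ?case unfolding eq using int by auto
qed

text \<open>\<open>weight k i\<close> is the coefficient of \<open>X (- i)\<close> in \<open>vol k\<close>, seen as an affine function of the
  past values, and \<open>vol0 k\<close> is what remains when the past is set to zero.\<close>

definition weight :: "nat \<Rightarrow> nat \<Rightarrow> 'a \<Rightarrow> real" where
  "weight k i \<omega> = volterra a (\<lambda>s. Z (int s) \<omega>) (\<lambda>t. a (t + i)) k"

definition vol0 :: "nat \<Rightarrow> 'a \<Rightarrow> real" where
  "vol0 k \<omega> = volterra a (\<lambda>s. Z (int s) \<omega>) (\<lambda>_. a 0) k"

lemma weight_measurable_gen: "1 \<le> k \<Longrightarrow> weight k i \<in> borel_measurable (gen_alg M Z {1..<int k})"
  and vol0_measurable_gen: "1 \<le> k \<Longrightarrow> vol0 k \<in> borel_measurable (gen_alg M Z {1..<int k})"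
  unfolding weight_def[abs_def] vol0_def[abs_def] by (rule volterra_measurable, assumption)+

text \<open>The mean of the random coefficient solves the deterministic renewal recursion with
  forcing \<open>a (t + i)\<close>.\<close>

lemma weight_expectation:
  assumes k: "1 \<le> k"
  shows "integrable M (weight k i)" "expectation (weight k i) \<le> (\<Sum>j<k. \<bar>\<psi> j\<bar> * a (k - j + i))"
proof -
  show "integrable M (weight k i)"
    unfolding weight_def[abs_def] using volterra_integrable[OF k] by blast
  have s: "(\<Sum>j. a (Suc j)) < 1" using a_sum(2) \<delta>0 by simp
  have "expectation (weight k i) = volterra a (\<lambda>_. 1) (\<lambda>t. a (t + i)) k"
    unfolding weight_def[abs_def] using volterra_integrable[OF k] by blast
  also have "\<dots> = (\<Sum>j<k. \<psi> j * a (k - j + i))"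
    by (rule volterra_renewal[OF renewal_fps[OF a_pos a_sum(1) s \<psi>] k])
  also have "\<dots> \<le> (\<Sum>j<k. \<bar>\<psi> j\<bar> * a (k - j + i))"
    by (intro sum_mono mult_right_mono less_imp_le[OF a_pos]) simp
  finally show "expectation (weight k i) \<le> (\<Sum>j<k. \<bar>\<psi> j\<bar> * a (k - j + i))" .
qed

text \<open>Splitting the lag sum at time 0 shows that \<open>vol\<close> solves a Volterra
  recursion whose forcing is \<open>a 0\<close> plus the past contribution. Linearity then isolates
  the coefficient of each past value.\<close>

lemma AE_vol_decomp:
  assumes k: "1 \<le> k"
  shows "AE \<omega> in M. a 0 \<le> vol0 k \<omega> \<and> (\<forall>i. 0 \<le> weight k i \<omega> * X\<^sub>c (- int i) \<omega>) \<and>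
    (\<forall>i. 0 \<le> weight k i \<omega> \<and> 0 \<le> X\<^sub>c (- int i) \<omega>) \<and>
    (\<lambda>i. weight k i \<omega> * X\<^sub>c (- int i) \<omega>) sums (vol (int k) \<omega> - vol0 k \<omega>)"
proof -
  have "AE \<omega> in M. \<forall>t. 0 \<le> X t \<omega>" using X_nonneg by (simp add: AE_all_countable)
  with AE_recursion show ?thesis
  proof eventually_elim
    case (elim \<omega>)
    have Xc: "X\<^sub>c t \<omega> = X t \<omega>" for t using elim(1) by simp
    have Z: "0 < Z t \<omega>" and sm: "summable (\<lambda>j. a (Suc j) * X (t - int (Suc j)) \<omega>)"
      and XZ: "X t \<omega> = Z t \<omega> * vol t \<omega>" for t
      using elim(1) by blast+
    have X: "0 \<le> X t \<omega>" for t using elim(2) by blast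
    define b where "b t = (\<Sum>i. a (t + i) * X (- int i) \<omega>)" for t
    define z where "z s = Z (int s) \<omega>" for s
    \<comment> \<open>Index \<open>j\<close> stands for lag \<open>j + 1\<close>, so the lags
      reaching the past, those at least \<open>t\<close>, are the indices from \<open>t - 1\<close>
      on.\<close>
    have shift: "(\<lambda>i. a (t + i) * X (- int i) \<omega>) = (\<lambda>i. a (Suc (i + (t - 1))) * X (int t - int (Suc (i + (t - 1)))) \<omega>)"
      if "1 \<le> t" for t
    proof (rule ext)
      fix i
      have "Suc (i + (t - 1)) = t + i" using that by simp
      moreover have "int t - int (t + i) = - int i" by simp
      ultimately show "a (t + i) * X (- int i) \<omega> = a (Suc (i + (t - 1))) * X (int t - int (Suc (i + (t - 1)))) \<omega>"
        by (simp only:)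
    qed
    have b: "(\<lambda>i. a (t + i) * X (- int i) \<omega>) sums b t" if "1 \<le> t" for t
      unfolding b_def shift[OF that]
      by (intro summable_sums) (subst summable_iff_shift[where f = "\<lambda>j. a (Suc j) * X (int t - int (Suc j)) \<omega>"], rule sm)
    have rec: "vol (int t) \<omega> = (a 0 + b t) + (\<Sum>s\<in>{1..<t}. a (t - s) * z s * vol (int s) \<omega>)" if t: "1 \<le> t" for t
    proof -
      have "vol (int t) \<omega> = a 0 + (\<Sum>j. a (Suc j) * X (int t - int (Suc j)) \<omega>)"
        by (simp only: vol_def Xc)
      also have "(\<Sum>j. a (Suc j) * X (int t - int (Suc j)) \<omega>)
          = b t + (\<Sum>j<t - 1. a (Suc j) * X (int t - int (Suc j)) \<omega>)"
        unfolding b_def shift[OF t] by (rule suminf_split_initial_segment[OF sm])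
      \<comment> \<open>The remaining lags reach times 1 to \<open>t - 1\<close>, where
        \<open>X s = Z s * vol s\<close> closes the recursion in \<open>vol\<close>.\<close>
      also have "(\<Sum>j<t - 1. a (Suc j) * X (int t - int (Suc j)) \<omega>)
          = (\<Sum>s\<in>{1..<t}. a (t - s) * z s * vol (int s) \<omega>)"
      proof (rule sum.reindex_bij_witness[of _ "\<lambda>s. t - Suc s" "\<lambda>j. t - Suc j"])
        fix j assume j: "j \<in> {..<t - 1}"
        then have "int t - int (Suc j) = int (t - Suc j)" and "t - (t - Suc j) = Suc j" by auto
        then show "a (t - (t - Suc j)) * z (t - Suc j) * vol (int (t - Suc j)) \<omega>
            = a (Suc j) * X (int t - int (Suc j)) \<omega>"
          by (simp only: z_def XZ mult.assoc)
      qed auto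
      finally show ?thesis by simp
    qed
    have vol: "vol (int k) \<omega> = volterra a z (\<lambda>t. a 0 + b t) k"
      by (rule volterra_unique[OF rec k])
    have vol0: "vol0 k \<omega> = volterra a z (\<lambda>_. a 0) k"
      unfolding vol0_def z_def ..
    have "(\<lambda>i. volterra a z (\<lambda>t. a (t + i) * X (- int i) \<omega>) k) sums volterra a z b k"
      by (rule volterra_sums[OF b k])
    then have "(\<lambda>i. weight k i \<omega> * X (- int i) \<omega>) sums volterra a z b k"
      unfolding volterra_cmult weight_def z_def .
    then have s: "(\<lambda>i. weight k i \<omega> * X (- int i) \<omega>) sums (vol (int k) \<omega> - vol0 k \<omega>)"
      unfolding vol vol0 volterra_add by simp
    have w: "0 \<le> weight k i \<omega>" for i
      unfolding weight_def by (rule volterra_nonneg[OF _ _ _ k]) (auto intro: less_imp_le a_pos Z)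
    have "0 \<le> (\<Sum>s\<in>{1..<k}. a (k - s) * z s * volterra a z (\<lambda>_. a 0) s)"
      unfolding z_def
      by (intro sum_nonneg mult_nonneg_nonneg volterra_nonneg) (auto intro: less_imp_le a_pos Z)
    then have "a 0 \<le> vol0 k \<omega>"
      unfolding vol0 by (subst volterra.simps) simp
    with s w X show ?case unfolding Xc by (auto intro: mult_nonneg_nonneg)
  qed
qed

text \<open>The power \<open>\<nu> / (\<nu> + 1)\<close> is the \<open>\<nu>\<close>-th power raised
  to \<open>1 / (\<nu> + 1)\<close>, so Jensen's inequality brings in the \<open>\<nu>\<close>-th
  moment. Stationarity moves it to time 0.\<close>

lemma lag_powr_expectation:
  "(\<integral>\<^sup>+\<omega>. ennreal (\<bar>X\<^sub>c t \<omega>\<bar> powr (\<nu> / (\<nu> + 1))) \<partial>M)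
    \<le> ennreal (expectation (\<lambda>\<omega>. \<bar>X 0 \<omega>\<bar> powr \<nu>) powr (1 / (\<nu> + 1)))"
proof -
  have q: "0 < 1 / (\<nu> + 1)" "1 / (\<nu> + 1) < 1" using \<nu> by auto
  have eq: "(\<bar>x\<bar> powr \<nu>) powr (1 / (\<nu> + 1)) = \<bar>x\<bar> powr (\<nu> / (\<nu> + 1))" for x :: real
    by (simp add: powr_powr)
  note J = expectation_powr_le[OF X_moment[of t] _ q, unfolded eq]
  have i: "integrable M (\<lambda>\<omega>. \<bar>X t \<omega>\<bar> powr (\<nu> / (\<nu> + 1)))" by (rule J(1)) simp
  have "(\<integral>\<^sup>+\<omega>. ennreal (\<bar>X\<^sub>c t \<omega>\<bar> powr (\<nu> / (\<nu> + 1))) \<partial>M) = (\<integral>\<^sup>+\<omega>. ennreal (\<bar>X t \<omega>\<bar> powr (\<nu> / (\<nu> + 1))) \<partial>M)"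
    using X\<^sub>c(2)[of t] by (intro nn_integral_cong_AE) (auto elim: eventually_mono)
  also have "\<dots> = ennreal (expectation (\<lambda>\<omega>. \<bar>X t \<omega>\<bar> powr (\<nu> / (\<nu> + 1))))"
    by (rule nn_integral_eq_integral[OF i]) simp
  also have "\<dots> \<le> ennreal (expectation (\<lambda>\<omega>. \<bar>X t \<omega>\<bar> powr \<nu>) powr (1 / (\<nu> + 1)))"
    by (intro ennreal_leI J(2)) simp
  also have "expectation (\<lambda>\<omega>. \<bar>X t \<omega>\<bar> powr \<nu>) = expectation (\<lambda>\<omega>. \<bar>X 0 \<omega>\<bar> powr \<nu>)"
    by (rule expectation_X) simp
  finally show ?thesis .
qed

section \<open>Conditional laws and the covariance bound\<close>

text \<open>This is the conditional probability of \<open>X t\<close> falling in \<open>B\<close>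
  when the volatility is frozen at \<open>s\<close>.\<close>

definition \<phi> :: "int \<Rightarrow> real set \<Rightarrow> real \<Rightarrow> real" where
  "\<phi> t B s = prob {\<omega> \<in> space M. Z t \<omega> * s \<in> B}"

lemma ennreal_\<phi>:
  assumes [measurable]: "B \<in> sets borel"
  shows "ennreal (\<phi> t B s) = (\<integral>\<^sup>+\<omega>. indicator B (Z t \<omega> * s) \<partial>M)"
proof -
  have "(\<integral>\<^sup>+\<omega>. indicator B (Z t \<omega> * s) \<partial>M) = (\<integral>\<^sup>+\<omega>. indicator {\<omega> \<in> space M. Z t \<omega> * s \<in> B} \<omega> \<partial>M)"
    by (intro nn_integral_cong) (auto split: split_indicator)
  then show ?thesis by (simp add: \<phi>_def emeasure_eq_measure)
qed

text \<open>Written as a nonnegative integral with parameter \<open>s\<close>, the function is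
  measurable by Tonelli's theorem.\<close>

lemma \<phi>_measurable [measurable]:
  assumes [measurable]: "B \<in> sets borel"
  shows "\<phi> t B \<in> borel_measurable borel"
proof -
  have "(\<lambda>s. enn2real (\<integral>\<^sup>+\<omega>. indicator B (Z t \<omega> * s) \<partial>M)) \<in> borel_measurable borel"
    by measurable
  moreover have "\<phi> t B = (\<lambda>s. enn2real (\<integral>\<^sup>+\<omega>. indicator B (Z t \<omega> * s) \<partial>M))"
    by (rule ext) (simp add: ennreal_\<phi>[symmetric] \<phi>_def)
  ultimately show ?thesis by simp
qed

lemma \<phi>_bounds: "0 \<le> \<phi> t B s" "\<phi> t B s \<le> 1"
  by (simp_all add: \<phi>_def)

text \<open>The event \<open>H\<close> and \<open>vol t\<close> are determined by innovations before
  \<open>t\<close>, so \<open>Z t\<close> can be integrated out while they are held fixed.\<close>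

lemma prob_conditional:
  assumes B: "B \<in> sets borel" and H: "H \<in> generated_by M Z {..<t}"
  shows "prob {\<omega> \<in> H. Z t \<omega> * vol t \<omega> \<in> B} = expectation (\<lambda>\<omega>. indicator H \<omega> * \<phi> t B (vol t \<omega>))"
proof -
  note [measurable] = B
  have [measurable]: "H \<in> sets M" using H generated_by_sets[of Z M "{..<t}"] by auto
  have Hs: "H \<subseteq> space M" by (rule sets.sets_into_space) simp
  have [measurable]: "H \<in> sets (gen_alg M Z {..<t})" using H by (simp add: sets_gen_alg)
  have [measurable]: "vol t \<in> borel_measurable (gen_alg M Z {..<t})" by (rule vol_measurable_gen)
  have [measurable]: "Z t \<in> borel_measurable (gen_alg M Z {t})" by (rule measurable_gen_alg_component) simp
  define h :: "(ennreal \<times> real) \<times> (ennreal \<times> real) \<Rightarrow> ennreal"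
    where "h x = fst (fst x) * indicator B (snd (snd x) * snd (fst x))" for x
  \<comment> \<open>\<open>indep_var\<close> requires both variables to have the same range type, hence the dummy component.\<close>
  have ind: "indep_var (borel \<Otimes>\<^sub>M borel) (\<lambda>\<omega>. (indicator H \<omega> :: ennreal, vol t \<omega>))
      (borel \<Otimes>\<^sub>M borel) (\<lambda>\<omega>. (0 :: ennreal, Z t \<omega>))"
    by (rule indep_var_gen_alg[OF Z_indep, where S = "{..<t}" and T = "{t}"]) (simp, measurable)
  have "{\<omega> \<in> H. Z t \<omega> * vol t \<omega> \<in> B} = {\<omega> \<in> space M. \<omega> \<in> H \<and> Z t \<omega> * vol t \<omega> \<in> B}" using Hs by auto
  then have [measurable]: "{\<omega> \<in> H. Z t \<omega> * vol t \<omega> \<in> B} \<in> sets M" by simp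
  have "ennreal (prob {\<omega> \<in> H. Z t \<omega> * vol t \<omega> \<in> B}) = (\<integral>\<^sup>+\<omega>. indicator {\<omega> \<in> H. Z t \<omega> * vol t \<omega> \<in> B} \<omega> \<partial>M)"
    by (simp add: emeasure_eq_measure)
  also have "\<dots> = (\<integral>\<^sup>+\<omega>. h ((indicator H \<omega>, vol t \<omega>), (0, Z t \<omega>)) \<partial>M)"
    by (intro nn_integral_cong) (auto simp: h_def split: split_indicator)
  also have "\<dots> = (\<integral>\<^sup>+\<omega>. (\<integral>\<^sup>+\<omega>'. h ((indicator H \<omega>, vol t \<omega>), (0, Z t \<omega>')) \<partial>M) \<partial>M)"
    by (rule indep_var_nn_integral_pair[OF ind]) (unfold h_def[abs_def], measurable)
  also have "\<dots> = (\<integral>\<^sup>+\<omega>. ennreal (indicator H \<omega> * \<phi> t B (vol t \<omega>)) \<partial>M)"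
    by (simp add: h_def nn_integral_cmult ennreal_\<phi>[OF B, symmetric] ennreal_mult' ennreal_indicator)
  also have "\<dots> = ennreal (expectation (\<lambda>\<omega>. indicator H \<omega> * \<phi> t B (vol t \<omega>)))"
    using \<phi>_bounds
    by (intro nn_integral_eq_integral integrable_const_bound[where B = 1])
      (auto split: split_indicator)
  finally show ?thesis
    by (subst (asm) ennreal_inj) (auto intro!: integral_nonneg_AE simp: \<phi>_bounds)
qed

lemma K0_pos: "0 < K0" and \<phi>_diff:
  "B \<in> sets borel \<Longrightarrow> 0 < s' \<Longrightarrow> s' \<le> s \<Longrightarrow> \<bar>\<phi> t B s - \<phi> t B s'\<bar> \<le> 2 * K0 * ((s - s') / s')"
proof -
  have fint: "integrable lborel f" "(\<integral>u. f u \<partial>lborel) = 1"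
    using distributed_integrable[OF Z_density[of 0], of "\<lambda>_. 1"]
      distributed_integral[OF Z_density[of 0], of "\<lambda>_. 1"] f_nonneg prob_space by auto
  show "0 < K0"
    \<comment> \<open>Dilation by the factor 2 gives \<open>1 / 2 \<le> K0\<close>.\<close>
    using density_dilation_L1(1)[OF fint f_nonneg, of 1 K0] f_scale[of 1] by simp
  show "\<bar>\<phi> t B s - \<phi> t B s'\<bar> \<le> 2 * K0 * ((s - s') / s')"
    if "B \<in> sets borel" "0 < s'" "s' \<le> s"
    unfolding \<phi>_def using that by (intro prob_scaled_diff_le[OF Z_density f_nonneg f_scale]) auto
qed

text \<open>Replacing the past by zero turns the conditional law of \<open>X k\<close> into one that is
  independent of the past, so only the difference of the two contributes to the covariance.\<close>

lemma covariance_le: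
  assumes k: "1 \<le> k" and B: "B \<in> sets borel" and H: "H \<in> generated_by M X {..0}"
  shows "\<bar>prob (X (int k) -` B \<inter> space M \<inter> H) - prob (X (int k) -` B \<inter> space M) * prob H\<bar>
    \<le> expectation (\<lambda>\<omega>. \<bar>\<phi> (int k) B (vol (int k) \<omega>) - \<phi> (int k) B (vol0 k \<omega>)\<bar>)"
proof -
  note [measurable] = B
  define G where "G = X (int k) -` B \<inter> space M"
  define u where "u \<omega> = \<phi> (int k) B (vol (int k) \<omega>)" for \<omega>
  define v where "v \<omega> = \<phi> (int k) B (vol0 k \<omega>)" for \<omega>
  have v_gen: "v \<in> borel_measurable (gen_alg M Z {1..<int k})"
    unfolding v_def[abs_def] by (rule measurable_compose[OF vol0_measurable_gen[OF k] \<phi>_measurable[OF B]])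
  have [measurable]: "u \<in> borel_measurable M" unfolding u_def[abs_def] by measurable
  have [measurable]: "v \<in> borel_measurable M" by (rule measurable_gen_alg_imp[OF Z_measurable v_gen])
  have uv: "0 \<le> u \<omega>" "u \<omega> \<le> 1" "0 \<le> v \<omega>" "v \<omega> \<le> 1" for \<omega>
    by (simp_all add: u_def v_def \<phi>_bounds)
  \<comment> \<open>\<open>X\<close> is a function of the innovations only almost surely. Replacing
    \<open>H\<close> by \<open>H'\<close> gives an event determined by the innovations up to time
    0.\<close>
  obtain H' where H': "H' \<in> generated_by M X\<^sub>c {..0}" "AE \<omega> in M. \<omega> \<in> H \<longleftrightarrow> \<omega> \<in> H'"
    using AE_eq_generated_by[OF X\<^sub>c(2) H] by blast
  have H'0: "H' \<in> generated_by M Z {..0}"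
    by (rule subsetD[OF generated_by_subset H'(1)]) (auto intro: measurable_gen_alg_mono[OF X\<^sub>c(1)])
  have H'k: "H' \<in> generated_by M Z {..<int k}"
    by (rule subsetD[OF generated_by_mono H'0]) (use k in auto)
  have Sk: "space M \<in> generated_by M Z {..<int k}"
    using sets.top[of "gen_alg M Z {..<int k}"] by (simp add: sets_gen_alg)
  have [measurable]: "H' \<in> sets M" using H'0 generated_by_sets[of Z M] by auto
  have [measurable]: "H \<in> sets M" using H generated_by_sets[of X M] by auto
  have [measurable]: "G \<in> sets M" unfolding G_def by measurable
  have H's: "H' \<subseteq> space M" by (rule sets.sets_into_space) simp
  have "AE \<omega> in M. X (int k) \<omega> = Z (int k) \<omega> * vol (int k) \<omega>"
    using AE_recursion by eventually_elim blast
  note AEs = this H'(2)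
  have e1: "prob (G \<inter> H) = prob {\<omega> \<in> H'. Z (int k) \<omega> * vol (int k) \<omega> \<in> B}"
  proof (rule finite_measure_eq_AE)
    show "AE \<omega> in M. \<omega> \<in> G \<inter> H \<longleftrightarrow> \<omega> \<in> {\<omega> \<in> H'. Z (int k) \<omega> * vol (int k) \<omega> \<in> B}"
      using AEs AE_space by eventually_elim (auto simp: G_def)
    have "{\<omega> \<in> H'. Z (int k) \<omega> * vol (int k) \<omega> \<in> B} = {\<omega> \<in> space M. \<omega> \<in> H' \<and> Z (int k) \<omega> * vol (int k) \<omega> \<in> B}"
      using H's by auto
    then show "{\<omega> \<in> H'. Z (int k) \<omega> * vol (int k) \<omega> \<in> B} \<in> sets M" by simp
  qed simp
  have e2: "prob G = prob {\<omega> \<in> space M. Z (int k) \<omega> * vol (int k) \<omega> \<in> B}"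
    by (rule finite_measure_eq_AE) (use AEs(1) in \<open>auto simp: G_def elim!: eventually_mono\<close>)
  have e3: "prob H = prob H'" using H'(2) by (intro finite_measure_eq_AE) auto
  have bi: "integrable M (\<lambda>\<omega>. g \<omega> * h \<omega>)" if "g \<in> borel_measurable M" "h \<in> borel_measurable M"
    "\<And>\<omega>. \<bar>g \<omega>\<bar> \<le> 1" "\<And>\<omega>. \<bar>h \<omega>\<bar> \<le> 1" for g h :: "'a \<Rightarrow> real"
    by (rule integrable_const_bound[where B = 1])
      (use that mult_mono[OF that(3,4)] in \<open>auto simp: abs_mult\<close>)
  have iu: "integrable M u" and iv: "integrable M v"
    using bi[of "\<lambda>_. 1" u] bi[of "\<lambda>_. 1" v] uv by simp_all
  have iHu: "integrable M (\<lambda>\<omega>. indicator H' \<omega> * u \<omega>)" and iHv: "integrable M (\<lambda>\<omega>. indicator H' \<omega> * v \<omega>)"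
    by (rule bi, use uv in \<open>auto split: split_indicator\<close>)+
  have e4: "prob {\<omega> \<in> H'. Z (int k) \<omega> * vol (int k) \<omega> \<in> B} = expectation (\<lambda>\<omega>. indicator H' \<omega> * u \<omega>)"
    unfolding u_def by (rule prob_conditional[OF B H'k])
  have e5: "prob {\<omega> \<in> space M. Z (int k) \<omega> * vol (int k) \<omega> \<in> B} = expectation u"
  proof -
    have "prob {\<omega> \<in> space M. Z (int k) \<omega> * vol (int k) \<omega> \<in> B} = expectation (\<lambda>\<omega>. indicator (space M) \<omega> * u \<omega>)"
      unfolding u_def by (rule prob_conditional[OF B Sk])
    also have "\<dots> = expectation u" by (rule Bochner_Integration.integral_cong) auto
    finally show ?thesis .
  qed
  \<comment> \<open>\<open>v\<close> uses only innovations at times 1 to \<open>k - 1\<close>,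
    whereas \<open>H'\<close> uses those up to time 0.\<close>
  have ind: "indep_var borel (indicator H' :: 'a \<Rightarrow> real) borel v"
    by (rule indep_var_gen_alg[OF Z_indep _ _ v_gen, where S = "{..0}"])
      (auto simp: sets_gen_alg H'0 intro!: borel_measurable_indicator)
  have e6: "expectation (\<lambda>\<omega>. indicator H' \<omega> * v \<omega>) = prob H' * expectation v"
  proof -
    have "integrable M (indicator H' :: 'a \<Rightarrow> real)" by (rule integrable_const_bound[where B = 1]) auto
    from indep_var_lebesgue_integral[OF ind this iv] show ?thesis using H's by (simp add: Int_absorb2)
  qed
  have "prob (G \<inter> H) - prob G * prob H
      = expectation (\<lambda>\<omega>. indicator H' \<omega> * u \<omega>) - expectation u * prob H'"
    unfolding e1 e2 e3 e4 e5 ..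
  \<comment> \<open>By independence the \<open>v\<close> terms have mean zero in total. The
    integrand equals \<open>(indicator H' - prob H') * (u - v)\<close>, whose first factor is at
    most 1 in absolute value.\<close>
  also have "\<dots> = expectation (\<lambda>\<omega>. indicator H' \<omega> * u \<omega> - indicator H' \<omega> * v \<omega> - prob H' * (u \<omega> - v \<omega>))"
    using iu iv iHu iHv e6 by (simp add: algebra_simps)
  finally have "\<bar>prob (G \<inter> H) - prob G * prob H\<bar>
      \<le> expectation (\<lambda>\<omega>. \<bar>indicator H' \<omega> * u \<omega> - indicator H' \<omega> * v \<omega> - prob H' * (u \<omega> - v \<omega>)\<bar>)"
    by (simp only: integral_abs_bound)
  also have "\<dots> \<le> expectation (\<lambda>\<omega>. \<bar>u \<omega> - v \<omega>\<bar>)"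
  proof (rule integral_mono)
    fix \<omega>
    have "indicator H' \<omega> * u \<omega> - indicator H' \<omega> * v \<omega> - prob H' * (u \<omega> - v \<omega>)
        = (indicator H' \<omega> - prob H') * (u \<omega> - v \<omega>)" by (simp add: algebra_simps)
    moreover have "\<bar>indicator H' \<omega> - prob H'\<bar> \<le> 1"
      using measure_nonneg[of M H'] prob_le_1[of H'] by (cases "\<omega> \<in> H'") (simp_all add: abs_le_iff)
    ultimately show "\<bar>indicator H' \<omega> * u \<omega> - indicator H' \<omega> * v \<omega> - prob H' * (u \<omega> - v \<omega>)\<bar> \<le> \<bar>u \<omega> - v \<omega>\<bar>"
      by (simp add: abs_mult mult_left_le_one_le)
  qed (use iu iv iHu iHv in auto)
  finally show ?thesis unfolding G_def u_def v_def .
qed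

text \<open>The difference is at most 1 and at most a multiple of the series of weighted past
  values. Termwise powers make each summand a product of a weight and a past value, which are
  independent, and Jensen's inequality treats the two factors separately.\<close>

lemma mean_deviation_le:
  assumes k: "1 \<le> k" and B: "B \<in> sets borel"
  shows "ennreal (expectation (\<lambda>\<omega>. \<bar>\<phi> (int k) B (vol (int k) \<omega>) - \<phi> (int k) B (vol0 k \<omega>)\<bar>))
    \<le> ennreal (K0 powr (\<nu> / (\<nu> + 1)) * K_nu \<nu>) *
      (\<Sum>i. ennreal ((1 / a 0 * (\<Sum>j<k. \<bar>\<psi> j\<bar> * a (k - j + i))) powr (\<nu> / (\<nu> + 1)) *
        expectation (\<lambda>\<omega>. \<bar>X 0 \<omega>\<bar> powr \<nu>) powr (1 / (\<nu> + 1))))"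
proof -
  note [measurable] = B
  define p where "p = \<nu> / (\<nu> + 1)"
  have p: "0 < p" "p < 1" using \<nu> by (auto simp: p_def)
  define m where "m = expectation (\<lambda>\<omega>. \<bar>X 0 \<omega>\<bar> powr \<nu>) powr (1 / (\<nu> + 1))"
  define c where "c i = (\<Sum>j<k. \<bar>\<psi> j\<bar> * a (k - j + i))" for i
  have c: "0 \<le> c i" for i unfolding c_def by (intro sum_nonneg mult_nonneg_nonneg less_imp_le[OF a_pos]) simp
  \<comment> \<open>The lower bound \<open>a 0 \<le> vol0 k\<close> turns the relative change of
    scale into an absolute one.\<close>
  define C where "C = 2 * K0 / a 0"
  have C: "0 < C" using K0_pos a_pos by (simp add: C_def)
  define w where "w \<omega> = \<bar>\<phi> (int k) B (vol (int k) \<omega>) - \<phi> (int k) B (vol0 k \<omega>)\<bar>" for \<omega>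
  have [measurable]: "vol0 k \<in> borel_measurable M" "weight k i \<in> borel_measurable M" for i
    by (rule measurable_gen_alg_imp[OF Z_measurable], rule vol0_measurable_gen weight_measurable_gen, rule k)+
  have [measurable]: "w \<in> borel_measurable M" unfolding w_def[abs_def] by measurable
  have w1: "w \<omega> \<le> 1" for \<omega>
    using \<phi>_bounds[of "int k" B "vol (int k) \<omega>"] \<phi>_bounds[of "int k" B "vol0 k \<omega>"] by (auto simp: w_def abs_le_iff)
  have iw: "integrable M w"
    by (rule integrable_const_bound[where B = 1]) (use w1 in \<open>auto simp: w_def\<close>)
  have "AE \<omega> in M. ennreal (w \<omega>) \<le> (\<Sum>i. ennreal (C powr p) * (ennreal (weight k i \<omega> powr p) * ennreal (\<bar>X\<^sub>c (- int i) \<omega>\<bar> powr p)))"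
    using AE_vol_decomp[OF k]
  proof eventually_elim
    case (elim \<omega>)
    define D where "D = vol (int k) \<omega> - vol0 k \<omega>"
    have s: "(\<lambda>i. weight k i \<omega> * X\<^sub>c (- int i) \<omega>) sums D" using elim by (simp add: D_def)
    have D: "0 \<le> D" using sums_le[OF _ sums_zero s] elim by blast
    have v0: "0 < a 0" "a 0 \<le> vol0 k \<omega>" using a_pos elim by auto
    have "w \<omega> \<le> 2 * K0 * (D / vol0 k \<omega>)"
      unfolding w_def D_def by (rule \<phi>_diff[OF B]) (use v0 D in \<open>auto simp: D_def\<close>)
    also have "\<dots> \<le> 2 * K0 * (D / a 0)"
      using K0_pos v0 D by (intro mult_left_mono divide_left_mono) auto
    also have "\<dots> = C * D" by (simp add: C_def)
    finally have "ennreal (w \<omega>) \<le> ennreal (min 1 (C * D))" using w1 by (intro ennreal_leI) simp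
    also have "\<dots> \<le> (\<Sum>i. ennreal ((C * (weight k i \<omega> * X\<^sub>c (- int i) \<omega>)) powr p))"
      using s elim C p by (intro min_one_suminf_le_powr sums_mult) auto
    also have "\<dots> = (\<Sum>i. ennreal (C powr p) * (ennreal (weight k i \<omega> powr p) * ennreal (\<bar>X\<^sub>c (- int i) \<omega>\<bar> powr p)))"
      using elim C by (simp add: powr_mult ennreal_mult)
    finally show ?case .
  qed
  then have "(\<integral>\<^sup>+\<omega>. ennreal (w \<omega>) \<partial>M)
      \<le> (\<integral>\<^sup>+\<omega>. (\<Sum>i. ennreal (C powr p) * (ennreal (weight k i \<omega> powr p) * ennreal (\<bar>X\<^sub>c (- int i) \<omega>\<bar> powr p))) \<partial>M)"
    by (rule nn_integral_mono_AE)
  also have "\<dots> = (\<Sum>i. ennreal (C powr p) * (\<integral>\<^sup>+\<omega>. ennreal (weight k i \<omega> powr p) * ennreal (\<bar>X\<^sub>c (- int i) \<omega>\<bar> powr p) \<partial>M))"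
    by (subst nn_integral_suminf) (auto simp: nn_integral_cmult)
  also have "\<dots> \<le> (\<Sum>i. ennreal (K0 powr p * K_nu \<nu>) * ennreal ((1 / a 0 * c i) powr p * m))"
  proof (rule suminf_le)
    fix i
    have [measurable]: "weight k i \<in> borel_measurable (gen_alg M Z {1..<int k})" by (rule weight_measurable_gen[OF k])
    have [measurable]: "X\<^sub>c (- int i) \<in> borel_measurable (gen_alg M Z {..0})"
      by (rule measurable_gen_alg_mono[OF X\<^sub>c(1)]) auto
    have "(\<integral>\<^sup>+\<omega>. ennreal (weight k i \<omega> powr p) * ennreal (\<bar>X\<^sub>c (- int i) \<omega>\<bar> powr p) \<partial>M)
        = (\<integral>\<^sup>+\<omega>. ennreal (weight k i \<omega> powr p) \<partial>M) * (\<integral>\<^sup>+\<omega>. ennreal (\<bar>X\<^sub>c (- int i) \<omega>\<bar> powr p) \<partial>M)"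
      by (rule indep_var_nn_integral_mult, rule indep_var_gen_alg[OF Z_indep,
          where S = "{1..<int k}" and T = "{..0}"]) (force, measurable)
    also have "\<dots> \<le> ennreal (c i powr p) * ennreal m"
    proof (rule mult_mono)
      have w0: "AE \<omega> in M. 0 \<le> weight k i \<omega>" using AE_vol_decomp[OF k] by eventually_elim blast
      note J = expectation_powr_le[OF weight_expectation(1)[OF k] w0 p]
      have "(\<integral>\<^sup>+\<omega>. ennreal (weight k i \<omega> powr p) \<partial>M) = ennreal (expectation (\<lambda>\<omega>. weight k i \<omega> powr p))"
        by (rule nn_integral_eq_integral[OF J(1)]) simp
      also have "\<dots> \<le> ennreal (expectation (weight k i) powr p)" by (rule ennreal_leI[OF J(2)])
      also have "\<dots> \<le> ennreal (c i powr p)"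
        using p weight_expectation(2)[OF k, of i] w0
        by (intro ennreal_leI powr_mono2) (auto simp: c_def intro: integral_nonneg_AE)
      finally show "(\<integral>\<^sup>+\<omega>. ennreal (weight k i \<omega> powr p) \<partial>M) \<le> ennreal (c i powr p)" .
      show "(\<integral>\<^sup>+\<omega>. ennreal (\<bar>X\<^sub>c (- int i) \<omega>\<bar> powr p) \<partial>M) \<le> ennreal m"
        unfolding p_def m_def by (rule lag_powr_expectation)
    qed auto
    finally have "ennreal (C powr p) * (\<integral>\<^sup>+\<omega>. ennreal (weight k i \<omega> powr p) * ennreal (\<bar>X\<^sub>c (- int i) \<omega>\<bar> powr p) \<partial>M)
        \<le> ennreal (C powr p) * (ennreal (c i powr p) * ennreal m)" by (rule mult_left_mono) simp
    also have "\<dots> = ennreal (C powr p * (c i powr p * m))"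
      by (simp add: ennreal_mult m_def)
    also have "C powr p * (c i powr p * m) = 2 powr p * (K0 powr p * ((1 / a 0 * c i) powr p * m))"
      using K0_pos a_pos[of 0] c[of i] by (simp add: C_def powr_mult powr_divide)
    also have "ennreal \<dots> \<le> ennreal (K_nu \<nu> * (K0 powr p * ((1 / a 0 * c i) powr p * m)))"
    proof (intro ennreal_leI mult_right_mono)
      have "2 powr p \<le> 2 powr (1 :: real)" using p by (intro powr_mono) auto
      with K_nu_ge[OF \<nu>] show "2 powr p \<le> K_nu \<nu>" by simp
    qed (simp add: m_def)
    also have "\<dots> = ennreal (K0 powr p * K_nu \<nu>) * ennreal ((1 / a 0 * c i) powr p * m)"
      using K_nu_ge[OF \<nu>] by (subst ennreal_mult[symmetric]) (auto simp: m_def mult_ac)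
    finally show "ennreal (C powr p) * (\<integral>\<^sup>+\<omega>. ennreal (weight k i \<omega> powr p) * ennreal (\<bar>X\<^sub>c (- int i) \<omega>\<bar> powr p) \<partial>M)
        \<le> ennreal (K0 powr p * K_nu \<nu>) * ennreal ((1 / a 0 * c i) powr p * m)" .
  qed (rule summableI)+
  also have "\<dots> = ennreal (K0 powr p * K_nu \<nu>) * (\<Sum>i. ennreal ((1 / a 0 * c i) powr p * m))"
    by (rule ennreal_suminf_cmult)
  also have "(\<integral>\<^sup>+\<omega>. ennreal (w \<omega>) \<partial>M) = ennreal (expectation w)"
    by (rule nn_integral_eq_integral[OF iw]) (simp add: w_def)
  finally show ?thesis unfolding w_def p_def m_def c_def .
qed

lemma mixing_bound:
  assumes k: "1 \<le> k"
  shows "ennreal (mixing_coeff M (generated_by M X {int k}) (generated_by M X {..0}))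
    \<le> ennreal (K0 powr (\<nu> / (\<nu> + 1)) * K_nu \<nu>) *
      (\<Sum>i. ennreal ((1 / a 0 * (\<Sum>j<k. \<bar>\<psi> j\<bar> * a (k - j + i))) powr (\<nu> / (\<nu> + 1)) *
        expectation (\<lambda>\<omega>. \<bar>X 0 \<omega>\<bar> powr \<nu>) powr (1 / (\<nu> + 1))))"
proof (rule mixing_coeff_le[OF _ empty_in_generated_by empty_in_generated_by])
  fix G H assume G: "G \<in> generated_by M X {int k}" and H: "H \<in> generated_by M X {..0}"
  obtain B where B: "B \<in> sets borel" and GB: "G = X (int k) -` B \<inter> space M"
    using generated_by_singleton[OF G] by blast
  show "ennreal \<bar>prob (G \<inter> H) - prob G * prob H\<bar>
    \<le> ennreal (K0 powr (\<nu> / (\<nu> + 1)) * K_nu \<nu>) *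
      (\<Sum>i. ennreal ((1 / a 0 * (\<Sum>j<k. \<bar>\<psi> j\<bar> * a (k - j + i))) powr (\<nu> / (\<nu> + 1)) *
        expectation (\<lambda>\<omega>. \<bar>X 0 \<omega>\<bar> powr \<nu>) powr (1 / (\<nu> + 1))))"
    unfolding GB by (rule order_trans[OF ennreal_leI[OF covariance_le[OF k B H]] mean_deviation_le[OF k B]])
qed

end

theorem theorem4p2:
  fixes M :: "'a measure"
    and X Z :: "int \<Rightarrow> 'a \<Rightarrow> real"
    and f :: "real \<Rightarrow> real"
    and a \<psi> :: "nat \<Rightarrow> real"
    and \<nu> \<delta>0 K0 :: real
  assumes "prob_space M"
    and Z_indep: "prob_space.indep_vars M (\<lambda>_. borel) Z UNIV"
    and Z_density: "\<And>t. distributed M lborel (Z t) (\<lambda>u. ennreal (f u))"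
    and f_nonneg: "\<And>u. 0 \<le> f u"
    and Z_pos: "\<And>t. AE \<omega> in M. 0 < Z t \<omega>"
    and Z_mean: "\<And>t. integrable M (Z t)" "\<And>t. (\<integral>\<omega>. Z t \<omega> \<partial>M) = 1"
    and a_pos: "\<And>j. 0 < a j"
    and \<delta>0: "0 < \<delta>0"
    and a_sum: "summable (\<lambda>j. a (Suc j))" "(\<Sum>j. a (Suc j)) < 1 - \<delta>0"
    and X_arch: "arch_infinity M a Z X"
    and \<nu>: "1 < \<nu>"
    and X_moment: "\<And>t. integrable M (\<lambda>\<omega>. \<bar>X t \<omega>\<bar> powr \<nu>)"
    and f_scale: "\<And>b. 0 < b \<Longrightarrow> (\<integral>u. \<bar>f u - f (u * (1 + b))\<bar> \<partial>lborel) \<le> K0 * b"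
    and \<psi>: "\<And>z :: complex. norm z \<le> 1 \<Longrightarrow>
        (\<lambda>j. of_real (\<psi> j) * z ^ j) sums
          inverse (1 - (\<Sum>j. of_real (a (Suc j)) * z ^ Suc j))"
  shows "(\<forall>k :: nat. 1 \<le> k \<longrightarrow>
      ennreal (mixing_coeff M (generated_by M X {int k}) (generated_by M X {..0}))
        \<le> ennreal (K0 powr (\<nu> / (\<nu> + 1)) * K_nu \<nu>) *
          (\<Sum>i. ennreal ((1 / a 0 * (\<Sum>j<k. \<bar>\<psi> j\<bar> * a (k - j + i))) powr (\<nu> / (\<nu> + 1)) *
                        (\<integral>\<omega>. \<bar>X 0 \<omega>\<bar> powr \<nu> \<partial>M) powr (1 / (\<nu> + 1))))) \<and>
    (\<forall>\<delta> :: real. a \<in> \<Theta>(\<lambda>j. real j powr (- \<delta>)) \<and> (\<lambda>j. \<bar>\<psi> j\<bar>) \<in> \<Theta>(\<lambda>j. real j powr (- \<delta>)) \<longrightarrow>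
      (\<exists>K. \<forall>k :: nat. 1 \<le> k \<longrightarrow>
        mixing_coeff M (generated_by M X {int k}) (generated_by M X {..0})
          \<le> K * (real k * (real k + 1) powr (- (\<delta> * (\<nu> / (\<nu> + 1))) + 1))))"
proof -
  interpret arch_process M X Z f a \<psi> \<nu> \<delta>0 K0
    by (intro arch_process.intro arch_process_axioms.intro; fact)
  show ?thesis
  proof (intro conjI allI impI)
    fix \<delta> :: real
    assume \<delta>: "a \<in> \<Theta>(\<lambda>j. real j powr (- \<delta>)) \<and> (\<lambda>j. \<bar>\<psi> j\<bar>) \<in> \<Theta>(\<lambda>j. real j powr (- \<delta>))"
    show "\<exists>K. \<forall>k :: nat. 1 \<le> k \<longrightarrow>
        mixing_coeff M (generated_by M X {int k}) (generated_by M X {..0})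
          \<le> K * (real k * (real k + 1) powr (- (\<delta> * (\<nu> / (\<nu> + 1))) + 1))"
    \<comment> \<open>The upper halves of the two order relations feed the rate estimate, with
      \<open>c = 1 / a 0\<close> and \<open>m\<close> the power of the moment of
      \<open>X 0\<close>.\<close>
    proof (rule mixing_rate_powr[OF _ _ less_imp_le[OF a_pos] _ _ _ mixing_coeff_le_one mixing_bound])
      show "a \<in> O(\<lambda>j. real j powr (- \<delta>))" "(\<lambda>j. \<bar>\<psi> j\<bar>) \<in> O(\<lambda>j. real j powr (- \<delta>))"
        using \<delta> by (auto dest: bigthetaD1)
      show "0 \<le> 1 / a 0" using a_pos[of 0] by simp
      show "0 \<le> K0 powr (\<nu> / (\<nu> + 1)) * K_nu \<nu>" using K_nu_ge[OF \<nu>] by simp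
    qed (use \<nu> in auto)
  qed (rule mixing_bound)
qed

end
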